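(* Let $\beta>0$ and let $G(s)=\exp(-\beta s)$. Then the Fokker--Planck equation $$\frac{\partial\varrho}{\partial t}=\frac12\,\Delta\bigl(G(W\ast\varrho)^2\varrho\bigr)\qquad\text{on }\mathbb T^d$$ admits, for smooth strictly positive $\varrho=\varrho(t,x)$, the gradient flow form $$\frac{\partial\varrho}{\partial t}=\nabla\cdot\left(\mathfrak m(\varrho)\,\nabla\frac{\delta\mathcal F_\beta}{\delta\varrho}\right),\qquad \mathfrak m(\varrho):=\frac12\,G(W\ast\varrho)^2\varrho,$$ that is, for every smooth strictly positive $\varrho$ on $\mathbb T^d$ the right-hand sides of the two equations coincide. In particular, $t\mapsto\mathcal F_\beta(\varrho(t))$ is nonincreasing along every smooth positive solution $\varrho$ of the Fokker--Planck equation.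
   Context: $\mathbb T^d=\mathbb R^d/\mathbb Z^d$. The kernel $W:\mathbb T^d\to[0,\infty)$ is bounded, radially symmetric (in particular even), nonincreasing with respect to $|x|$, obtained by periodic extension of a compactly supported function on $\mathbb R^d$, and normalized by $\int_{\mathbb T^d}W\,\mathrm dx=1$. $W\ast\varrho$ denotes the (periodic) convolution in the space variable. The free energy is $$\mathcal F_\beta(\varrho)=\int_{\mathbb T^d}\varrho(\log\varrho-1)\,\mathrm dx-\beta\int_{\mathbb T^d}\varrho\,(W\ast\varrho)\,\mathrm dx .$$ $\frac{\delta\mathcal F_\beta}{\delta\varrho}$ denotes its first variation, i.e. the function on $\mathbb T^d$ with $\frac{\mathrm d}{\mathrm d\varepsilon}\mathcal F_\beta(\varrho+\varepsilon\eta)\big|_{\varepsilon=0}=\int_{\mathbb T^d}\frac{\delta\mathcal F_\beta}{\delta\varrho}\,\eta\,\mathrm dx$ for all smooth $\eta$. *)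

theory Defs
  imports "HOL-Analysis.Analysis"
begin

text \<open>Functions on the torus \<open>\<real>\<^sup>d / \<int>\<^sup>d\<close> are represented by \<open>\<int>\<^sup>d\<close>-periodic functions on
  \<open>\<real>\<^sup>d\<close>, with \<open>d = CARD('d)\<close>, and integrals over the torus by integrals over a unit cell.\<close>

definition int_lattice :: "(real^'d) set" where
  "int_lattice = {k. \<forall>i. k $ i \<in> \<int>}"

definition torus_fun :: "(real^'d \<Rightarrow> real) \<Rightarrow> bool" where
  "torus_fun f \<longleftrightarrow> (\<forall>k\<in>int_lattice. \<forall>x. f (x + k) = f x)"

definition torus_integral :: "(real^'d \<Rightarrow> real) \<Rightarrow> real" where
  "torus_integral f = (LINT x:cbox 0 1|lborel. f x)"

text \<open>\<open>|x|\<close> on the torus is the distance of the class of \<open>x\<close> to the class of \<open>0\<close>; for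
  \<open>x\<close> in \<open>[-1/2, 1/2]\<^sup>d\<close> it is the Euclidean norm.\<close>

definition torus_norm :: "real^'d \<Rightarrow> real" where
  "torus_norm x = infdist x int_lattice"

definition torus_conv :: "(real^'d \<Rightarrow> real) \<Rightarrow> (real^'d \<Rightarrow> real) \<Rightarrow> real^'d \<Rightarrow> real" where
  "torus_conv W \<rho> x = torus_integral (\<lambda>y. W (x - y) * \<rho> y)"

text \<open>\<open>C\<^sup>k\<close> regularity through all directional derivatives. On \<open>UNIV\<close>, or on any convex set with
  nonempty interior, the derivative \<open>f'\<close> is unique on \<open>S\<close>; at boundary points of \<open>S\<close> it is
  one-sided.\<close>

fun Ck_on :: "nat \<Rightarrow> 'a::euclidean_space set \<Rightarrow> ('a \<Rightarrow> real) \<Rightarrow> bool" where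
  "Ck_on 0 S f \<longleftrightarrow> continuous_on S f"
| "Ck_on (Suc k) S f \<longleftrightarrow>
     (\<exists>f'. (\<forall>x\<in>S. (f has_derivative f' x) (at x within S)) \<and> (\<forall>h. Ck_on k S (\<lambda>x. f' x h)))"

definition smooth_on :: "'a::euclidean_space set \<Rightarrow> ('a \<Rightarrow> real) \<Rightarrow> bool" where
  "smooth_on S f \<longleftrightarrow> (\<forall>k. Ck_on k S f)"

definition torus_smooth :: "(real^'d \<Rightarrow> real) \<Rightarrow> bool" where
  "torus_smooth f \<longleftrightarrow> torus_fun f \<and> smooth_on UNIV f"

definition partial_deriv :: "'d \<Rightarrow> (real^'d \<Rightarrow> real) \<Rightarrow> real^'d \<Rightarrow> real" where
  "partial_deriv i f x = frechet_derivative f (at x) (axis i 1)"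

definition gradient :: "(real^'d \<Rightarrow> real) \<Rightarrow> real^'d \<Rightarrow> real^'d" where
  "gradient f x = (\<chi> i. partial_deriv i f x)"

definition divergence :: "(real^'d \<Rightarrow> real^'d) \<Rightarrow> real^'d \<Rightarrow> real" where
  "divergence V x = (\<Sum>i\<in>UNIV. partial_deriv i (\<lambda>y. V y $ i) x)"

definition laplacian :: "(real^'d \<Rightarrow> real) \<Rightarrow> real^'d \<Rightarrow> real" where
  "laplacian f x = (\<Sum>i\<in>UNIV. partial_deriv i (partial_deriv i f) x)"

text \<open>The fourth conjunct contains radial symmetry (two points of equal norm have equal values) as
  well as monotonicity. In the fifth one, the lattice sum has only finitely many nonzero terms.
  Measurability of \<open>W\<close> is implied by the last one, as a non-integrable function has integral 0.\<close>

definition interaction_kernel :: "(real^'d \<Rightarrow> real) \<Rightarrow> bool" where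
  "interaction_kernel W \<longleftrightarrow>
     torus_fun W \<and>
     (\<forall>x. 0 \<le> W x) \<and>
     bounded (range W) \<and>
     (\<forall>x y. torus_norm x \<le> torus_norm y \<longrightarrow> W y \<le> W x) \<and>
     (\<exists>w. compact (closure {x. w x \<noteq> 0}) \<and> (\<forall>x. W x = (\<Sum>\<^sub>\<infinity>k\<in>int_lattice. w (x + k)))) \<and>
     torus_integral W = 1"

definition free_energy :: "real \<Rightarrow> (real^'d \<Rightarrow> real) \<Rightarrow> (real^'d \<Rightarrow> real) \<Rightarrow> real" where
  "free_energy \<beta> W \<rho> =
     torus_integral (\<lambda>x. \<rho> x * (ln (\<rho> x) - 1)) -
     \<beta> * torus_integral (\<lambda>x. \<rho> x * torus_conv W \<rho> x)"

text \<open>The test functions determine the first variation only up to null sets, so it is required to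
  be continuous; this makes it unique.\<close>

definition has_first_variation ::
    "((real^'d \<Rightarrow> real) \<Rightarrow> real) \<Rightarrow> (real^'d \<Rightarrow> real) \<Rightarrow> (real^'d \<Rightarrow> real) \<Rightarrow> bool" where
  "has_first_variation F \<rho> \<phi> \<longleftrightarrow>
     torus_fun \<phi> \<and> continuous_on UNIV \<phi> \<and>
     (\<forall>\<eta>. torus_smooth \<eta> \<longrightarrow>
        ((\<lambda>\<epsilon>. F (\<lambda>x. \<rho> x + \<epsilon> * \<eta> x)) has_real_derivative
           torus_integral (\<lambda>x. \<phi> x * \<eta> x)) (at 0))"

definition first_variation ::
    "((real^'d \<Rightarrow> real) \<Rightarrow> real) \<Rightarrow> (real^'d \<Rightarrow> real) \<Rightarrow> real^'d \<Rightarrow> real" where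
  "first_variation F \<rho> = (THE \<phi>. has_first_variation F \<rho> \<phi>)"

definition mobility ::
    "(real \<Rightarrow> real) \<Rightarrow> (real^'d \<Rightarrow> real) \<Rightarrow> (real^'d \<Rightarrow> real) \<Rightarrow> real^'d \<Rightarrow> real" where
  "mobility G W \<rho> x = 1/2 * (G (torus_conv W \<rho> x))\<^sup>2 * \<rho> x"

definition fokker_planck_rhs ::
    "(real \<Rightarrow> real) \<Rightarrow> (real^'d \<Rightarrow> real) \<Rightarrow> (real^'d \<Rightarrow> real) \<Rightarrow> real^'d \<Rightarrow> real" where
  "fokker_planck_rhs G W \<rho> x = 1/2 * laplacian (\<lambda>y. (G (torus_conv W \<rho> y))\<^sup>2 * \<rho> y) x"

definition gradient_flow_rhs ::
    "(real \<Rightarrow> real) \<Rightarrow> (real^'d \<Rightarrow> real) \<Rightarrow> ((real^'d \<Rightarrow> real) \<Rightarrow> real) \<Rightarrow> (real^'d \<Rightarrow> real)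
       \<Rightarrow> real^'d \<Rightarrow> real" where
  "gradient_flow_rhs G W F \<rho> x =
     divergence (\<lambda>y. mobility G W \<rho> y *\<^sub>R gradient (first_variation F \<rho>) y) x"

text \<open>The time interval \<open>I\<close> may be open, closed or half-open; at an endpoint belonging to \<open>I\<close> all
  time derivatives are one-sided.\<close>

definition smooth_positive_fp_solution ::
    "(real \<Rightarrow> real) \<Rightarrow> (real^'d \<Rightarrow> real) \<Rightarrow> real set \<Rightarrow> (real \<Rightarrow> real^'d \<Rightarrow> real) \<Rightarrow> bool" where
  "smooth_positive_fp_solution G W I \<rho> \<longleftrightarrow>
     smooth_on (I \<times> UNIV) (\<lambda>p. \<rho> (fst p) (snd p)) \<and>
     (\<forall>t\<in>I. torus_fun (\<rho> t)) \<and>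
     (\<forall>t\<in>I. \<forall>x. 0 < \<rho> t x) \<and>
     (\<forall>t\<in>I. \<forall>x. ((\<lambda>s. \<rho> s x) has_real_derivative fokker_planck_rhs G W (\<rho> t) x) (at t within I))"

end

theory Submission
  imports Defs
begin

text \<open>The first variation of the free energy at \<open>\<rho>\<close> is \<open>\<phi> = ln \<rho> - 2 \<beta> W * \<rho>\<close>, the factor 2 coming
  from the evenness of \<open>W\<close>; it is unique because trigonometric polynomials are dense. Since
  \<open>G (W * \<rho>)\<^sup>2 \<rho> = exp \<phi>\<close>, both right-hand sides equal \<open>1/2\<close> times the divergence of
  \<open>exp \<phi> \<nabla>\<phi> = \<nabla> exp \<phi>\<close>. Along a solution the energy therefore has derivative
  \<open>\<integral> \<phi> \<partial>\<^sub>t \<rho> = - 1/2 \<integral> exp \<phi> |\<nabla>\<phi>|\<^sup>2 \<le> 0\<close>, integrating by parts on the torus. The kernel may be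
  discontinuous, so derivatives of \<open>W * \<rho>\<close> are put on \<open>\<rho>\<close>.\<close>

subsection \<open>Integration over the torus\<close>

text \<open>As \<open>W\<close> may jump, \<open>W * \<rho>\<close> cannot be differentiated in the
  form in which it is defined, where the point enters through \<open>W\<close>. Substituting
  \<open>y = x + z\<close> moves the point into \<rho>, at the price of the translation invariance
  of the torus integral. For an integral over a fixed cell this is not immediate; it is obtained by
  comparing fundamental domains of the lattice. From then on, every differentiation under the
  integral is dominated convergence, with bounds supplied by continuity and periodicity as long as
  time stays in a compact interval. The first variation and the dissipation are two instances of one
  chain rule for the energy: along the segment \<open>\<rho> + \<epsilon> \<eta>\<close> and along a
  solution.\<close>

abbreviation unit_cell :: "(real^'d) measure" where
  "unit_cell \<equiv> restrict_space lborel (cbox 0 1)"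

lemma torus_integral_eq: "torus_integral f = (LINT x|unit_cell. f x)"
  unfolding torus_integral_def set_lebesgue_integral_def
  by (subst integral_restrict_space) auto

lemma space_unit_cell [simp]: "space unit_cell = cbox 0 1"
  by (simp add: space_restrict_space)

lemma finite_measure_unit_cell: "finite_measure (unit_cell :: (real^'d) measure)"
  by (rule finite_measureI) (simp add: emeasure_restrict_space emeasure_lborel_cbox_eq)

lemma measurable_unit_cell:
  "f \<in> borel_measurable borel \<Longrightarrow> f \<in> borel_measurable unit_cell"
  by (rule measurable_restrict_space1) simp

lemma integrable_unit_cell:
  fixes f :: "real^'d \<Rightarrow> real"
  assumes "f \<in> borel_measurable borel" "\<And>x. x \<in> cbox 0 1 \<Longrightarrow> \<bar>f x\<bar> \<le> C"
  shows "integrable unit_cell f"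
  by (rule finite_measure.integrable_const_bound[OF finite_measure_unit_cell, of _ C])
    (use assms measurable_unit_cell in auto)

text \<open>The representative in the unit cell of the class of \<open>x\<close>; through it, bounds
  and identities known on the cell pass to the whole space.\<close>

definition frac_part :: "real^'d \<Rightarrow> real^'d" where
  "frac_part x = (\<chi> i. frac (x $ i))"

lemma int_lattice_0 [simp]: "0 \<in> int_lattice"
  and int_lattice_uminus: "k \<in> int_lattice \<Longrightarrow> - k \<in> int_lattice"
  by (auto simp: int_lattice_def)

lemma countable_int_lattice: "countable (int_lattice :: (real^'d) set)"
proof -
  have "int_lattice \<subseteq> range (\<lambda>f :: 'd \<Rightarrow> int. \<chi> i. of_int (f i))"
  proof
    fix k :: "real^'d" assume "k \<in> int_lattice"
    then have "k = (\<chi> i. of_int \<lfloor>k $ i\<rfloor>)"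
      by (auto simp: int_lattice_def vec_eq_iff)
    then show "k \<in> range (\<lambda>f :: 'd \<Rightarrow> int. \<chi> i. of_int (f i))" by (intro image_eqI[where x="\<lambda>i. \<lfloor>k $ i\<rfloor>"]) auto
  qed
  then show ?thesis by (rule countable_subset) simp
qed

lemma frac_part_lattice: "frac_part x - x \<in> int_lattice"
  by (auto simp: int_lattice_def frac_part_def frac_def)

lemma frac_part_in_cbox: "frac_part x \<in> cbox 0 1"
  by (auto simp: mem_box_cart frac_part_def frac_ge_0 frac_lt_1 less_imp_le)

lemma torus_fun_frac_part: "torus_fun f \<Longrightarrow> f (frac_part x) = f x"
  unfolding torus_fun_def using frac_part_lattice[of x] by (metis add.commute diff_add_cancel)

lemma measurable_frac_part [measurable]: "frac_part \<in> borel_measurable borel"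
proof -
  have "(\<lambda>x::real^'d. frac_part x \<bullet> axis i 1) \<in> borel_measurable borel" for i
    by (simp add: frac_part_def inner_axis frac_def)
  then show ?thesis
    by (subst borel_measurable_euclidean_space) (auto simp: Basis_vec_def)
qed

lemma torus_fun_bounded:
  fixes f :: "real^'d \<Rightarrow> real"
  assumes "torus_fun f" "continuous_on UNIV f"
  obtains C where "\<And>x. \<bar>f x\<bar> \<le> C"
proof -
  have "compact (f ` cbox 0 1)"
    by (rule compact_continuous_image) (use assms continuous_on_subset in auto)
  then obtain C where "\<And>y. y \<in> f ` cbox 0 1 \<Longrightarrow> norm y \<le> C"
    by (meson bounded_iff compact_imp_bounded)
  then have "\<bar>f x\<bar> \<le> C" for x
    using torus_fun_frac_part[OF assms(1), of x] frac_part_in_cbox[of x] by (metis imageI real_norm_def)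
  then show ?thesis using that by blast
qed

section \<open>Fundamental domains of the lattice and translation invariance\<close>

definition fund_domain :: "(real^'d) set \<Rightarrow> bool" where
  "fund_domain D \<longleftrightarrow> D \<in> sets borel \<and> (\<forall>x. \<exists>!k. k \<in> int_lattice \<and> x + k \<in> D)"

lemma fund_domain_borel: "fund_domain D \<Longrightarrow> D \<in> sets borel"
  by (simp add: fund_domain_def)

text \<open>Cut \<open>D\<close> into the pieces that a lattice vector \<open>k\<close> moves into
  \<open>D'\<close> and translate each piece by its \<open>k\<close>: this reassembles
  \<open>D'\<close>. With nonnegative integrands, sum and integral may be exchanged freely.\<close>

lemma nn_integral_fund_domain:
  fixes D D' :: "(real^'d) set" and f :: "real^'d \<Rightarrow> ennreal"
  assumes D: "fund_domain D" and D': "fund_domain D'"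
    and f [measurable]: "f \<in> borel_measurable borel"
    and per: "\<And>k x. k \<in> int_lattice \<Longrightarrow> f (x + k) = f x"
  shows "(\<integral>\<^sup>+x. indicator D x * f x \<partial>lborel) = (\<integral>\<^sup>+x. indicator D' x * f x \<partial>lborel)"
proof -
  have [measurable]: "D \<in> sets borel" "D' \<in> sets borel" by (rule fund_domain_borel, fact)+
  let ?L = "int_lattice :: (real^'d) set"
  \<comment> \<open>Exactly one lattice translate of \<open>x\<close> lies in \<open>E\<close>, so
    this sum can be inserted as a factor 1.\<close>
  have one: "(\<integral>\<^sup>+k. indicator E (x + k) \<partial>count_space ?L) = 1" if E: "fund_domain E" for E x
  proof -
    obtain k where k: "k \<in> ?L" "x + k \<in> E" "\<And>l. l \<in> ?L \<Longrightarrow> x + l \<in> E \<Longrightarrow> l = k"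
      using E unfolding fund_domain_def by metis
    have "(\<integral>\<^sup>+l. indicator E (x + l) \<partial>count_space ?L) = (\<integral>\<^sup>+l. indicator {k} l \<partial>count_space ?L)"
      using k(2) by (intro nn_integral_cong) (auto simp: indicator_def dest: k(3))
    also have "\<dots> = emeasure (count_space ?L) {k}"
      using k(1) by (intro nn_integral_indicator) simp
    also have "\<dots> = 1" using k(1) by simp
    finally show ?thesis .
  qed
  have expand: "(\<integral>\<^sup>+x. indicator A x * f x \<partial>lborel) =
      (\<integral>\<^sup>+k. \<integral>\<^sup>+x. indicator A x * f x * indicator B (x + k) \<partial>lborel \<partial>count_space ?L)"
    if A: "fund_domain A" and B: "fund_domain B" for A B
  proof -
    have [measurable]: "A \<in> sets borel" "B \<in> sets borel" by (rule fund_domain_borel, fact)+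
    have "(\<integral>\<^sup>+k. indicator A x * f x * indicator B (x + k) \<partial>count_space ?L) = indicator A x * f x" for x
      using nn_integral_cmult[of "\<lambda>k. indicator B (x + k)" "count_space ?L" "indicator A x * f x"]
      by (simp only: one[OF B] mult_1_right) simp
    then have "(\<integral>\<^sup>+x. indicator A x * f x \<partial>lborel) =
        (\<integral>\<^sup>+x. \<integral>\<^sup>+k. indicator A x * f x * indicator B (x + k) \<partial>count_space ?L \<partial>lborel)"
      by (simp only:)
    also have "\<dots> = (\<integral>\<^sup>+k. \<integral>\<^sup>+x. indicator A x * f x * indicator B (x + k) \<partial>lborel \<partial>count_space ?L)"
      by (rule nn_integral_count_space_nn_integral) (auto simp: countable_int_lattice)
    finally show ?thesis .
  qed
  \<comment> \<open>Translation by \<open>k\<close>, together with the periodicity of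
    \<open>f\<close>, moves each piece from one domain to the other.\<close>
  have "(\<integral>\<^sup>+x. indicator D x * f x * indicator D' (x + k) \<partial>lborel) =
      (\<integral>\<^sup>+x. indicator D' x * f x * indicator D (x - k) \<partial>lborel)" if "k \<in> ?L" for k
  proof -
    have "(\<integral>\<^sup>+x. indicator D' x * f x * indicator D (x - k) \<partial>lborel) =
        (\<integral>\<^sup>+x. indicator D' x * f x * indicator D (x - k) \<partial>distr lborel borel ((+) k))"
      by (simp only: lborel_distr_plus)
    also have "\<dots> = (\<integral>\<^sup>+x. indicator D' (k + x) * f (k + x) * indicator D (k + x - k) \<partial>lborel)"
      by (rule nn_integral_distr) measurable
    also have "\<dots> = (\<integral>\<^sup>+x. indicator D x * f x * indicator D' (x + k) \<partial>lborel)"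
      using per[OF that] by (intro nn_integral_cong) (simp add: add.commute[of k] mult_ac)
    finally show ?thesis by simp
  qed
  then have "(\<integral>\<^sup>+x. indicator D x * f x \<partial>lborel) =
      (\<integral>\<^sup>+k. \<integral>\<^sup>+x. indicator D' x * f x * indicator D (x - k) \<partial>lborel \<partial>count_space ?L)"
    unfolding expand[OF D D'] by (rule nn_integral_cong) simp
  \<comment> \<open>Reindexing by \<open>k \<mapsto> - k\<close> brings the sum into the form of
    \<open>expand\<close>.\<close>
  also have "\<dots> = (\<integral>\<^sup>+k. \<integral>\<^sup>+x. indicator D' x * f x * indicator D (x + k) \<partial>lborel \<partial>count_space ?L)"
    by (subst nn_integral_bij_count_space[of uminus ?L ?L, symmetric])
      (auto intro!: bij_betw_byWitness[where f'=uminus] int_lattice_uminus)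
  also have "\<dots> = (\<integral>\<^sup>+x. indicator D' x * f x \<partial>lborel)"
    by (rule expand[OF D' D, symmetric])
  finally show ?thesis .
qed

text \<open>The closed cell is not a fundamental domain, as its opposite faces carry the same points
  of the torus.\<close>

definition half_open_cell :: "(real^'d) set" where
  "half_open_cell = {x. \<forall>i. 0 \<le> x $ i \<and> x $ i < 1}"

lemma fund_domain_half_open:
  fixes a :: "real^'d"
  shows "fund_domain ((\<lambda>x. x + a) -` half_open_cell)"
  unfolding fund_domain_def
proof (intro conjI allI)
  have "half_open_cell \<in> sets (borel :: (real^'d) measure)"
  proof -
    have "half_open_cell = (\<Inter>i. {x::real^'d. 0 \<le> x $ i} \<inter> {x. x $ i < 1})"
      by (auto simp: half_open_cell_def)
    also have "\<dots> \<in> sets borel"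
      by (intro sets.finite_INT sets.Int borel_closed borel_open)
         (auto intro!: closed_Collect_le open_Collect_less continuous_intros)
    finally show ?thesis .
  qed
  then show "(\<lambda>x. x + a) -` half_open_cell \<in> sets borel"
    by (intro measurable_sets_borel) auto
  fix x :: "real^'d"
  show "\<exists>!k. k \<in> int_lattice \<and> x + k \<in> (\<lambda>x. x + a) -` half_open_cell"
  \<comment> \<open>The only possible vector is the one that replaces every coordinate of
    \<open>x + a\<close> by its fractional part.\<close>
  proof (rule ex1I[of _ "frac_part (x + a) - (x + a)"])
    show "frac_part (x + a) - (x + a) \<in> int_lattice \<and>
        x + (frac_part (x + a) - (x + a)) \<in> (\<lambda>x. x + a) -` half_open_cell"
      using frac_part_lattice[of "x + a"]
      by (simp add: half_open_cell_def) (simp add: frac_part_def frac_ge_0 frac_lt_1)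
    fix k assume k: "k \<in> int_lattice \<and> x + k \<in> (\<lambda>x. x + a) -` half_open_cell"
    have "k $ i = frac (x $ i + a $ i) - (x $ i + a $ i)" for i
    proof -
      have "0 \<le> x $ i + k $ i + a $ i" "x $ i + k $ i + a $ i < 1"
        using k by (auto simp: half_open_cell_def)
      then have "frac (x $ i + k $ i + a $ i) = x $ i + k $ i + a $ i" by (simp add: frac_eq)
      moreover obtain m where "k $ i = of_int m"
        using k by (auto simp: int_lattice_def elim!: Ints_cases)
      ultimately show ?thesis
        by (auto simp: frac_def add_ac)
    qed
    then show "k = frac_part (x + a) - (x + a)" by (simp add: vec_eq_iff frac_part_def)
  qed
qed

text \<open>The two cells differ only on the boundary of the cube, which is null because the open
  and the closed box have the same volume.\<close>

lemma AE_half_open_cell: "AE x in lborel. x \<in> cbox 0 (1::real^'d) \<longleftrightarrow> x \<in> half_open_cell"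
proof -
  have "emeasure lborel (cbox 0 1 - box 0 (1::real^'d)) = 0"
    by (subst emeasure_Diff) (auto simp: emeasure_lborel_cbox_eq emeasure_lborel_box_eq box_subset_cbox)
  then have "AE x in lborel. x \<notin> cbox 0 1 - box 0 (1::real^'d)"
    by (intro AE_not_in null_setsI) auto
  then show ?thesis
    by (rule AE_mp) (auto intro!: AE_I2 simp: half_open_cell_def mem_box_cart less_imp_le)
qed

lemma torus_integral_half_open_cell:
  fixes f :: "real^'d \<Rightarrow> real"
  assumes [measurable]: "f \<in> borel_measurable borel"
  shows "torus_integral f = (LINT x|lborel. indicator half_open_cell x * f x)"
  unfolding torus_integral_def set_lebesgue_integral_def
proof (rule integral_cong_AE)
  have [measurable]: "half_open_cell \<in> sets (borel :: (real^'d) measure)"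
    using fund_domain_borel[OF fund_domain_half_open[of "0::real^'d"]] by simp
  show "(\<lambda>x. indicator half_open_cell x * f x) \<in> borel_measurable lborel" by measurable
  show "AE x in lborel. indicator (cbox 0 1) x *\<^sub>R f x = indicator half_open_cell x * f x"
    using AE_half_open_cell by eventually_elim (auto simp: indicator_def)
qed auto

text \<open>Translating the integrand amounts to translating the cell, and the translated cell is
  another fundamental domain. The bound makes all integrals finite, so that positive and negative
  parts can be subtracted.\<close>

lemma torus_integral_translate:
  fixes f :: "real^'d \<Rightarrow> real"
  assumes per: "torus_fun f" and [measurable]: "f \<in> borel_measurable borel"
    and bd: "\<And>x. \<bar>f x\<bar> \<le> C"
  shows "torus_integral (\<lambda>x. f (x + a)) = torus_integral f"
proof -
  have sb: "half_open_cell \<in> sets (borel :: (real^'d) measure)"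
    using fund_domain_borel[OF fund_domain_half_open[of "0::real^'d"]] by simp
  let ?D = "\<lambda>a. (\<lambda>x::real^'d. x + a) -` half_open_cell"
  have bD [measurable]: "?D a \<in> sets borel" for a
    by (rule fund_domain_borel[OF fund_domain_half_open])
  have fin: "emeasure lborel (half_open_cell :: (real^'d) set) < \<infinity>"
  proof -
    have "emeasure lborel (half_open_cell :: (real^'d) set) \<le> emeasure lborel (cbox 0 (1::real^'d))"
      by (rule emeasure_mono) (auto simp: half_open_cell_def mem_box_cart less_imp_le)
    also have "\<dots> < \<infinity>" by (rule emeasure_lborel_cbox_finite)
    finally show ?thesis .
  qed
  have int: "(LINT x|lborel. indicator (?D (-a)) x * f x) = (LINT x|lborel. indicator (?D 0) x * f x)"
  proof -
    \<comment> \<open>\<open>ennreal\<close> sends negative values to 0, so \<open>g = f\<close> and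
      \<open>g = - f\<close> give the positive and the negative part of \<open>f\<close>.\<close>
    have shift: "(\<integral>\<^sup>+x. ennreal (indicator (?D (-a)) x * g x) \<partial>lborel) =
        (\<integral>\<^sup>+x. ennreal (indicator (?D 0) x * g x) \<partial>lborel)"
      if "g \<in> borel_measurable borel" "torus_fun g" for g
      using nn_integral_fund_domain[OF fund_domain_half_open[of "-a"] fund_domain_half_open[of 0],
          of "\<lambda>x. ennreal (g x)"] that
      by (simp add: torus_fun_def indicator_mult_ennreal)
    have fD: "emeasure lborel (?D b) < \<infinity>" for b
    proof -
      have "emeasure lborel (?D b) = emeasure (distr lborel borel ((+) b)) half_open_cell"
        using sb by (subst emeasure_distr) (auto simp: vimage_def add.commute)
      then show ?thesis using fin by (simp add: lborel_distr_plus)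
    qed
    have int: "integrable lborel (\<lambda>x. indicator (?D b) x * f x)" for b
    proof (rule Bochner_Integration.integrable_bound)
      show "integrable lborel (\<lambda>x. C * indicator (?D b) x :: real)"
        using fD[of b] by (intro integrable_mult_right integrable_real_indicator) auto
      show "AE x in lborel. norm (indicator (?D b) x * f x) \<le> norm (C * indicator (?D b) x)"
        using bd by (auto simp: indicator_def intro: order_trans[OF _ abs_ge_self])
    qed auto
    have mf: "torus_fun (\<lambda>x. - f x)" using per by (simp add: torus_fun_def)
    show ?thesis
      unfolding real_lebesgue_integral_def[OF int] using shift[OF _ per] shift[OF _ mf] by simp
  qed
  have "torus_integral (\<lambda>x. f (x + a)) = (LINT x|lborel. indicator (?D 0) x * f (x + a))"
    by (subst torus_integral_half_open_cell) auto
  also have "\<dots> = (LINT x|distr lborel borel ((+) a). indicator (?D (-a)) x * f x)"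
    by (subst integral_distr) (measurable, simp add: indicator_def add.commute)
  also have "\<dots> = (LINT x|lborel. indicator (?D 0) x * f x)"
    by (simp only: lborel_distr_plus int)
  also have "\<dots> = torus_integral f"
    using torus_integral_half_open_cell[of f] by simp
  finally show ?thesis .
qed

subsection \<open>Differentiation under the integral\<close>

text \<open>Dominated convergence for the remainder quotients along sequences. Convexity of
  \<open>T\<close> is there for the mean value inequality. Derivatives within \<open>T\<close> allow
  for one-sided time derivatives, and the general parameter space covers the space variable as
  well.\<close>

lemma integral_has_derivative:
  fixes f :: "'p::real_normed_vector \<Rightarrow> 'a \<Rightarrow> real"
  assumes M: "finite_measure M" and T: "convex T" "p0 \<in> T"
    and deriv: "\<And>p z. p \<in> T \<Longrightarrow> z \<in> space M \<Longrightarrow> ((\<lambda>p. f p z) has_derivative f' p z) (at p within T)"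
    and bd: "\<And>p z. p \<in> T \<Longrightarrow> z \<in> space M \<Longrightarrow> onorm (f' p z) \<le> C"
    and int: "\<And>p. p \<in> T \<Longrightarrow> integrable M (f p)"
    and meas: "\<And>h. (\<lambda>z. f' p0 z h) \<in> borel_measurable M"
  shows "((\<lambda>p. \<integral>z. f p z \<partial>M) has_derivative (\<lambda>h. \<integral>z. f' p0 z h \<partial>M)) (at p0 within T)"
proof -
  interpret finite_measure M by fact
  have bl: "bounded_linear (f' p0 z)" if "z \<in> space M" for z
    using deriv[OF T(2) that] by (rule has_derivative_bounded_linear)
  have f'_le: "\<bar>f' p0 z h\<bar> \<le> C * norm h" if "z \<in> space M" for z h
    using onorm[OF bl[OF that], of h] bd[OF T(2) that] mult_right_mono[of "onorm (f' p0 z)" C "norm h"]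
    by (simp add: order_trans)
  have int': "integrable M (\<lambda>z. f' p0 z h)" for h
    by (rule integrable_const_bound[of _ "C * norm h"]) (use f'_le meas in auto)
  have lin: "bounded_linear (\<lambda>h. \<integral>z. f' p0 z h \<partial>M)"
  proof (rule bounded_linear_intro)
    show "(\<integral>z. f' p0 z (h + k) \<partial>M) = (\<integral>z. f' p0 z h \<partial>M) + (\<integral>z. f' p0 z k \<partial>M)" for h k
      by (subst Bochner_Integration.integral_add[symmetric, OF int' int'])
        (auto intro!: Bochner_Integration.integral_cong simp: bl bounded_linear.linear linear_add)
    show "(\<integral>z. f' p0 z (c *\<^sub>R h) \<partial>M) = c *\<^sub>R (\<integral>z. f' p0 z h \<partial>M)" for c h
    proof -
      have "(\<integral>z. f' p0 z (c *\<^sub>R h) \<partial>M) = (\<integral>z. c * f' p0 z h \<partial>M)"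
        by (rule Bochner_Integration.integral_cong[OF refl])
          (simp add: bl bounded_linear.linear linear_scale)
      also have "\<dots> = c *\<^sub>R (\<integral>z. f' p0 z h \<partial>M)" by simp
      finally show ?thesis .
    qed
    fix h
    have "norm (\<integral>z. f' p0 z h \<partial>M) \<le> (\<integral>z. norm (f' p0 z h) \<partial>M)"
      by (rule integral_norm_bound)
    also have "\<dots> \<le> (\<integral>z. C * norm h \<partial>M)"
      by (rule integral_mono) (use int' f'_le in auto)
    finally show "norm (\<integral>z. f' p0 z h \<partial>M) \<le> norm h * (C * measure M (space M))"
      by (simp add: mult_ac)
  qed
  have "(\<lambda>i. norm ((\<integral>z. f (X i) z \<partial>M) - (\<integral>z. f p0 z \<partial>M) - (\<integral>z. f' p0 z (X i - p0) \<partial>M)) / norm (X i - p0))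
      \<longlonglongrightarrow> 0" if X: "\<And>i. X i \<in> T - {p0}" "X \<longlonglongrightarrow> p0" for X
  proof -
    \<comment> \<open>The remainder of the linear approximation at \<open>p0\<close>, divided by the
      size of the increment; its integral has to tend to 0.\<close>
    define g where "g i z = (f (X i) z - f p0 z - f' p0 z (X i - p0)) / norm (X i - p0)" for i z
    have g_meas: "g i \<in> borel_measurable M" for i
      unfolding g_def using X(1)[of i] T int meas by (auto intro!: borel_measurable_diff borel_measurable_divide)
    have "(\<lambda>i. \<integral>z. g i z \<partial>M) \<longlonglongrightarrow> (\<integral>z. 0 \<partial>M)"
    proof (rule integral_dominated_convergence)
      show "integrable M (\<lambda>z. C + C)" by simp
      show "AE z in M. norm (g i z) \<le> C + C" for i
      proof (rule AE_I2)
        fix z assume z: "z \<in> space M"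
        \<comment> \<open>The increment is bounded by the mean value inequality and the linear term
          by its operator norm, each contributing one \<open>C\<close>.\<close>
        have "norm (f (X i) z - f p0 z) \<le> C * norm (X i - p0)"
          using differentiable_bound[OF T(1), of "\<lambda>p. f p z" "\<lambda>p. f' p z"] deriv bd z X(1) T by blast
        moreover have "norm (f' p0 z (X i - p0)) \<le> C * norm (X i - p0)"
          using f'_le z by simp
        ultimately have "norm (f (X i) z - f p0 z - f' p0 z (X i - p0)) \<le> (C + C) * norm (X i - p0)"
          using norm_triangle_ineq4[of "f (X i) z - f p0 z" "f' p0 z (X i - p0)"]
          by (simp add: distrib_right)
        then show "norm (g i z) \<le> C + C"
          using X(1)[of i] by (simp add: g_def divide_le_eq)
      qed
      show "AE z in M. (\<lambda>i. g i z) \<longlonglongrightarrow> 0"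
      proof (rule AE_I2)
        fix z assume z: "z \<in> space M"
        have "((\<lambda>y. norm (f y z - f p0 z - f' p0 z (y - p0)) / norm (y - p0)) \<longlongrightarrow> 0) (at p0 within T)"
          using deriv[OF T(2) z] by (simp add: has_derivative_iff_norm)
        then have "(\<lambda>i. norm (f (X i) z - f p0 z - f' p0 z (X i - p0)) / norm (X i - p0)) \<longlonglongrightarrow> 0"
          using X unfolding tendsto_at_iff_sequentially by (auto simp: comp_def)
        then show "(\<lambda>i. g i z) \<longlonglongrightarrow> 0"
          by (intro tendsto_norm_zero_cancel[of "\<lambda>i. g i z"]) (simp add: g_def abs_divide)
      qed
    qed (use g_meas in auto)
    moreover have "(\<integral>z. g i z \<partial>M) =
        ((\<integral>z. f (X i) z \<partial>M) - (\<integral>z. f p0 z \<partial>M) - (\<integral>z. f' p0 z (X i - p0) \<partial>M)) / norm (X i - p0)" for i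
      using X(1)[of i] T(2) int int' by (simp add: g_def)
    ultimately have "(\<lambda>i. norm (((\<integral>z. f (X i) z \<partial>M) - (\<integral>z. f p0 z \<partial>M) -
        (\<integral>z. f' p0 z (X i - p0) \<partial>M)) / norm (X i - p0))) \<longlonglongrightarrow> 0"
      by (intro tendsto_norm_zero) simp
    then show ?thesis by (simp add: abs_divide)
  qed
  then show ?thesis
    unfolding has_derivative_iff_norm tendsto_at_iff_sequentially comp_def using lin by auto
qed

lemma integral_has_real_derivative:
  fixes f :: "real \<Rightarrow> 'a \<Rightarrow> real"
  assumes "finite_measure M" "convex T" "t0 \<in> T"
    and deriv: "\<And>t z. t \<in> T \<Longrightarrow> z \<in> space M \<Longrightarrow> ((\<lambda>t. f t z) has_real_derivative f' t z) (at t within T)"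
    and bd: "\<And>t z. t \<in> T \<Longrightarrow> z \<in> space M \<Longrightarrow> \<bar>f' t z\<bar> \<le> C"
    and "\<And>t. t \<in> T \<Longrightarrow> integrable M (f t)"
    and "f' t0 \<in> borel_measurable M"
  shows "((\<lambda>t. \<integral>z. f t z \<partial>M) has_real_derivative (\<integral>z. f' t0 z \<partial>M)) (at t0 within T)"
proof -
  have "((\<lambda>t. \<integral>z. f t z \<partial>M) has_derivative (\<lambda>h. \<integral>z. f' t0 z * h \<partial>M)) (at t0 within T)"
  proof (rule integral_has_derivative[where C = C and f' = "\<lambda>t z h. f' t z * h"])
    show "onorm ((*) (f' t z)) \<le> C" if "t \<in> T" "z \<in> space M" for t z
      using bd[OF that] by (intro onorm_le) (simp add: abs_mult mult_right_mono)
    show "((\<lambda>t. f t z) has_derivative (*) (f' t z)) (at t within T)" if "t \<in> T" "z \<in> space M" for t z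
      using deriv[OF that] by (simp add: has_field_derivative_def)
  qed (use assms in auto)
  then show ?thesis
    by (simp add: has_field_derivative_def mult.commute[of _ "\<integral>z. f' t0 z \<partial>M"] fun_eq_iff)
qed

lemma integral_continuous_on:
  fixes f :: "'p::metric_space \<Rightarrow> 'a \<Rightarrow> real"
  assumes M: "finite_measure M"
    and cont: "\<And>z. z \<in> space M \<Longrightarrow> continuous_on T (\<lambda>p. f p z)"
    and bd: "\<And>p z. p \<in> T \<Longrightarrow> z \<in> space M \<Longrightarrow> \<bar>f p z\<bar> \<le> C"
    and meas: "\<And>p. p \<in> T \<Longrightarrow> f p \<in> borel_measurable M"
  shows "continuous_on T (\<lambda>p. \<integral>z. f p z \<partial>M)"
proof (rule continuous_on_sequentiallyI)
  fix u a assume u: "\<forall>n. u n \<in> T" "a \<in> T" "u \<longlonglongrightarrow> a"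
  show "(\<lambda>n. \<integral>z. f (u n) z \<partial>M) \<longlonglongrightarrow> (\<integral>z. f a z \<partial>M)"
  proof (rule integral_dominated_convergence)
    show "integrable M (\<lambda>z. C)" using M by (simp add: finite_measure.integrable_const)
    show "AE z in M. (\<lambda>n. f (u n) z) \<longlonglongrightarrow> f a z"
      using cont u unfolding continuous_on_sequentially by (auto simp: comp_def)
  qed (use bd meas u in auto)
qed

subsection \<open>Convolution with the kernel\<close>

lemma torus_norm_uminus: "torus_norm (- x) = torus_norm x"
proof -
  have L: "uminus ` int_lattice = (int_lattice :: (real^'a) set)"
    using int_lattice_uminus by (force simp: image_iff)
  have "infdist (- x) int_lattice = infdist (- x) (uminus ` int_lattice)"
    by (simp add: L)
  also have "\<dots> = infdist x int_lattice"
    by (auto simp: infdist_def image_image dist_minus)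
  finally show ?thesis by (simp add: torus_norm_def)
qed

lemma kernel_torus_fun: "interaction_kernel W \<Longrightarrow> torus_fun W"
  by (auto simp: interaction_kernel_def)

text \<open>\<open>x\<close> and \<open>- x\<close> are at the same distance from the lattice, so
  radial monotonicity applies in both directions.\<close>

lemma kernel_even: "interaction_kernel W \<Longrightarrow> W (- x) = W x"
  unfolding interaction_kernel_def by (metis torus_norm_uminus order_refl antisym)

lemma kernel_bounded:
  assumes "interaction_kernel W"
  obtains B where "B \<ge> 0" "\<And>x. \<bar>W x\<bar> \<le> B"
proof -
  have "bounded (range W)" using assms by (simp add: interaction_kernel_def)
  then obtain B where "\<And>x. \<bar>W x\<bar> \<le> B" by (auto simp: bounded_iff)
  then show ?thesis using that[of B] by (meson abs_ge_zero order_trans)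
qed

text \<open>The normalization gives measurability only on the cell; composition with
  \<open>frac_part\<close> spreads it periodically over the whole space.\<close>

lemma kernel_measurable:
  fixes W :: "real^'d \<Rightarrow> real"
  assumes W: "interaction_kernel W"
  shows "W \<in> borel_measurable borel"
proof -
  have "torus_integral W = 1" using W by (simp add: interaction_kernel_def)
  then have "integrable lborel (\<lambda>x. indicator (cbox 0 1) x *\<^sub>R W x)"
    unfolding torus_integral_def set_lebesgue_integral_def
    using not_integrable_integral_eq by fastforce
  then have [measurable]: "(\<lambda>x. indicator (cbox 0 1) x *\<^sub>R W x) \<in> borel_measurable borel"
    by (auto dest: borel_measurable_integrable)
  have "(\<lambda>x. indicator (cbox 0 1) (frac_part x) *\<^sub>R W (frac_part x)) \<in> borel_measurable borel"
    by measurable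
  then show ?thesis
    using kernel_torus_fun[OF W] by (simp add: torus_fun_frac_part frac_part_in_cbox)
qed

text \<open>Substitute \<open>y = x + z\<close> and apply evenness to \<open>W (- z)\<close>. The
  point \<open>x\<close> now occurs in \<rho> alone, so continuity and derivatives of the
  convolution are those of \<rho>.\<close>

lemma torus_conv_shift:
  fixes W \<rho> :: "real^'d \<Rightarrow> real"
  assumes W: "interaction_kernel W" and \<rho>: "torus_fun \<rho>" "continuous_on UNIV \<rho>"
  shows "torus_conv W \<rho> x = torus_integral (\<lambda>z. W z * \<rho> (x + z))"
proof -
  obtain B where B: "B \<ge> 0" "\<And>x. \<bar>W x\<bar> \<le> B" using kernel_bounded[OF W] by blast
  obtain C where C: "\<And>x. \<bar>\<rho> x\<bar> \<le> C" using torus_fun_bounded[OF \<rho>] by blast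
  have [measurable]: "W \<in> borel_measurable borel" "\<rho> \<in> borel_measurable borel"
    using kernel_measurable[OF W] borel_measurable_continuous_onI[OF \<rho>(2)] by auto
  have per: "torus_fun (\<lambda>y. W (x - y) * \<rho> y)"
    unfolding torus_fun_def
  proof (intro ballI allI)
    fix k y :: "real^'d" assume k: "k \<in> int_lattice"
    have "W (x - (y + k)) = W (x - y + - k)" by (simp add: algebra_simps)
    also have "\<dots> = W (x - y)"
      using kernel_torus_fun[OF W] int_lattice_uminus[OF k] unfolding torus_fun_def by blast
    finally show "W (x - (y + k)) * \<rho> (y + k) = W (x - y) * \<rho> y"
      using \<rho>(1) k by (simp add: torus_fun_def)
  qed
  have "torus_integral (\<lambda>z. W (x - (z + x)) * \<rho> (z + x)) = torus_integral (\<lambda>y. W (x - y) * \<rho> y)"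
    by (rule torus_integral_translate[OF per, of "B * C"])
      (use B C in \<open>auto simp: abs_mult intro!: mult_mono\<close>)
  then show ?thesis
    by (simp add: torus_conv_def kernel_even[OF W] add.commute)
qed

lemma torus_conv_torus_fun:
  assumes W: "interaction_kernel W" and \<rho>: "torus_fun \<rho>" "continuous_on UNIV \<rho>"
  shows "torus_fun (torus_conv W \<rho>)"
proof -
  have "\<rho> (x + k + z) = \<rho> (x + z)" if "k \<in> int_lattice" for x k z
    using \<rho>(1) that unfolding torus_fun_def by (metis add.assoc add.commute)
  then show ?thesis by (auto simp: torus_fun_def torus_conv_shift[OF assms])
qed

lemma torus_conv_continuous:
  fixes W \<rho> :: "real^'d \<Rightarrow> real"
  assumes W: "interaction_kernel W" and \<rho>: "torus_fun \<rho>" "continuous_on UNIV \<rho>"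
  shows "continuous_on UNIV (torus_conv W \<rho>)"
proof -
  obtain B where B: "B \<ge> 0" "\<And>x. \<bar>W x\<bar> \<le> B" using kernel_bounded[OF W] by blast
  obtain C where C: "\<And>x. \<bar>\<rho> x\<bar> \<le> C" using torus_fun_bounded[OF \<rho>] by blast
  have [measurable]: "W \<in> borel_measurable borel" "\<rho> \<in> borel_measurable borel"
    using kernel_measurable[OF W] borel_measurable_continuous_onI[OF \<rho>(2)] by auto
  have eq: "torus_conv W \<rho> = (\<lambda>x. \<integral>z. W z * \<rho> (x + z) \<partial>unit_cell)"
    using torus_conv_shift[OF assms] by (simp add: torus_integral_eq fun_eq_iff)
  show ?thesis
    unfolding eq
  proof (rule integral_continuous_on[OF finite_measure_unit_cell, where C = "B * C"])
    show "continuous_on UNIV (\<lambda>x. W z * \<rho> (x + z))" for z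
      by (intro continuous_intros continuous_on_compose2[OF \<rho>(2)]) auto
    show "\<bar>W z * \<rho> (x + z)\<bar> \<le> B * C" for x z
      using B C by (auto simp: abs_mult intro!: mult_mono)
    show "(\<lambda>z. W z * \<rho> (x + z)) \<in> borel_measurable unit_cell" for x
      by (rule measurable_unit_cell) measurable
  qed
qed

section \<open>Derivatives of periodic functions and of convolutions\<close>

lemma has_derivative_translate:
  fixes f :: "'a::real_normed_vector \<Rightarrow> 'b::real_normed_vector"
  assumes "(f has_derivative f') (at (x + a))"
  shows "((\<lambda>x. f (x + a)) has_derivative f') (at x)"
proof -
  have "((\<lambda>x. x + a) has_derivative (\<lambda>h. h)) (at x)" by (auto intro!: derivative_eq_intros)
  from has_derivative_compose[OF this, of f f'] assms show ?thesis by simp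
qed

lemma torus_fun_derivative:
  fixes f :: "real^'d \<Rightarrow> real"
  assumes f: "torus_fun f" and f': "\<And>x. (f has_derivative f' x) (at x)"
  shows "torus_fun (\<lambda>x. f' x h)"
  unfolding torus_fun_def
proof (intro ballI allI)
  fix k x :: "real^'d" assume "k \<in> int_lattice"
  then have "(\<lambda>x. f (x + k)) = f" using f by (auto simp: torus_fun_def)
  moreover have "((\<lambda>x. f (x + k)) has_derivative f' (x + k)) (at x)"
    by (rule has_derivative_translate[OF f'])
  ultimately have "f' (x + k) = f' x"
    using f'[of x] has_derivative_unique by metis
  then show "f' (x + k) h = f' x h" by simp
qed

text \<open>Each directional derivative is continuous and periodic, hence bounded, and the operator
  norm is at most the sum of their absolute values over the basis.\<close>

lemma onorm_derivative_bounded: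
  fixes f :: "real^'d \<Rightarrow> real"
  assumes f: "torus_fun f" and f': "\<And>x. (f has_derivative f' x) (at x)"
    and cont: "\<And>h. continuous_on UNIV (\<lambda>x. f' x h)"
  obtains C where "\<And>x. onorm (f' x) \<le> C"
proof -
  have "\<forall>b. \<exists>C. \<forall>x. \<bar>f' x b\<bar> \<le> C"
    using torus_fun_bounded[OF torus_fun_derivative[OF f f'] cont] by metis
  then obtain C where C: "\<And>b x. \<bar>f' x b\<bar> \<le> C b" by metis
  have "onorm (f' x) \<le> (\<Sum>b\<in>Basis. C b)" for x
    using onorm_componentwise[OF has_derivative_bounded_linear[OF f'[of x]]] sum_mono[of Basis "\<lambda>b. \<bar>f' x b\<bar>" C, OF C]
    by simp
  then show ?thesis using that by blast
qed

text \<open>The derivative is again a convolution with \<open>W\<close>, of a periodic directional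
  derivative of \<rho>, so the statement can be iterated.\<close>

lemma torus_conv_has_derivative:
  fixes W \<rho> :: "real^'d \<Rightarrow> real"
  assumes W: "interaction_kernel W" and \<rho>: "torus_fun \<rho>"
    and \<rho>': "\<And>x. (\<rho> has_derivative \<rho>' x) (at x)" and cont: "\<And>h. continuous_on UNIV (\<lambda>x. \<rho>' x h)"
  shows "(torus_conv W \<rho> has_derivative (\<lambda>h. torus_conv W (\<lambda>y. \<rho>' y h) x)) (at x)"
proof -
  have c\<rho>: "continuous_on UNIV \<rho>" using \<rho>' has_derivative_continuous_on by blast
  obtain B where B: "B \<ge> 0" "\<And>x. \<bar>W x\<bar> \<le> B" using kernel_bounded[OF W] by blast
  obtain C0 where C0: "\<And>x. \<bar>\<rho> x\<bar> \<le> C0" using torus_fun_bounded[OF \<rho> c\<rho>] by blast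
  obtain C where C: "\<And>x. onorm (\<rho>' x) \<le> C" using onorm_derivative_bounded[OF \<rho> \<rho>' cont] by blast
  have C_nonneg: "0 \<le> C"
    using onorm_pos_le[OF has_derivative_bounded_linear[OF \<rho>'[of 0]]] C[of 0] by simp
  have [measurable]: "W \<in> borel_measurable borel" "\<rho> \<in> borel_measurable borel"
      "\<And>h. (\<lambda>x. \<rho>' x h) \<in> borel_measurable borel"
    using kernel_measurable[OF W] borel_measurable_continuous_onI[OF c\<rho>]
      borel_measurable_continuous_onI[OF cont] by auto
  have "((\<lambda>x. \<integral>z. W z * \<rho> (x + z) \<partial>unit_cell) has_derivative
      (\<lambda>h. \<integral>z. W z * \<rho>' (x + z) h \<partial>unit_cell)) (at x)"
  proof (rule integral_has_derivative[OF finite_measure_unit_cell, where C = "B * C"])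
    fix y z :: "real^'d"
    have d: "((\<lambda>x. \<rho> (x + z)) has_derivative \<rho>' (y + z)) (at y)"
      by (rule has_derivative_translate[OF \<rho>'])
    then show "((\<lambda>x. W z * \<rho> (x + z)) has_derivative (\<lambda>h. W z * \<rho>' (y + z) h)) (at y)"
      by (auto intro!: derivative_eq_intros)
    show "onorm (\<lambda>h. W z * \<rho>' (y + z) h) \<le> B * C"
    proof (rule onorm_le)
      fix h
      have "\<bar>\<rho>' (y + z) h\<bar> \<le> C * norm h"
        using onorm[OF has_derivative_bounded_linear[OF \<rho>'[of "y + z"]], of h]
          mult_right_mono[OF C[of "y + z"], of "norm h"] by simp
      then show "norm (W z * \<rho>' (y + z) h) \<le> B * C * norm h"
        using B C_nonneg by (auto simp: abs_mult mult.assoc intro!: mult_mono)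
    qed
    show "integrable unit_cell (\<lambda>z. W z * \<rho> (y + z))"
      by (rule integrable_unit_cell[of _ "B * C0"])
        (use B C0 in \<open>auto simp: abs_mult intro!: mult_mono\<close>)
    show "(\<lambda>z. W z * \<rho>' (x + z) h) \<in> borel_measurable unit_cell" for h
      by (rule measurable_unit_cell) measurable
  qed auto
  moreover have "torus_conv W \<rho> = (\<lambda>x. \<integral>z. W z * \<rho> (x + z) \<partial>unit_cell)"
    using torus_conv_shift[OF W \<rho> c\<rho>] by (simp add: torus_integral_eq fun_eq_iff)
  moreover have "torus_conv W (\<lambda>y. \<rho>' y h) x = (\<integral>z. W z * \<rho>' (x + z) h \<partial>unit_cell)" for h
    using torus_conv_shift[OF W torus_fun_derivative[OF \<rho> \<rho>'] cont] by (simp add: torus_integral_eq)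
  ultimately show ?thesis by simp
qed

subsection \<open>Smooth functions\<close>

lemma Ck_on_continuous: "Ck_on k S f \<Longrightarrow> continuous_on S f"
  by (cases k) (auto intro: has_derivative_continuous_on)

lemma Ck_on_SucI:
  "(\<And>x. x \<in> S \<Longrightarrow> (f has_derivative f' x) (at x within S)) \<Longrightarrow>
    (\<And>h. Ck_on k S (\<lambda>x. f' x h)) \<Longrightarrow> Ck_on (Suc k) S f"
  by auto

lemma Ck_on_SucE:
  assumes "Ck_on (Suc k) S f"
  obtains f' where "\<And>x. x \<in> S \<Longrightarrow> (f has_derivative f' x) (at x within S)"
    "\<And>h. Ck_on k S (\<lambda>x. f' x h)"
  using assms by auto

text \<open>Derivatives of products and compositions contain the original functions, which the
  inductions below need at the lower order.\<close>

lemma Ck_on_Suc_D: "Ck_on (Suc k) S f \<Longrightarrow> Ck_on k S f"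
proof (induction k arbitrary: f)
  case 0
  then show ?case using Ck_on_continuous[of "Suc 0"] by (simp only: Ck_on.simps(1))
next
  case (Suc k)
  then obtain f' where f': "\<And>x. x \<in> S \<Longrightarrow> (f has_derivative f' x) (at x within S)"
    "\<And>h. Ck_on (Suc k) S (\<lambda>x. f' x h)" by (elim Ck_on_SucE) blast
  then show ?case by (intro Ck_on_SucI[OF f'(1)] Suc.IH)
qed

lemma Ck_on_subset: "Ck_on k S f \<Longrightarrow> T \<subseteq> S \<Longrightarrow> Ck_on k T f"
proof (induction k arbitrary: f)
  case 0
  then show ?case by (auto intro: continuous_on_subset)
next
  case (Suc k)
  then obtain f' where f': "\<And>x. x \<in> S \<Longrightarrow> (f has_derivative f' x) (at x within S)"
    "\<And>h. Ck_on k S (\<lambda>x. f' x h)" by (elim Ck_on_SucE) blast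
  have "(f has_derivative f' x) (at x within T)" if "x \<in> T" for x
    using has_derivative_subset[OF f'(1)] that Suc.prems(2) by blast
  then show ?case by (rule Ck_on_SucI[OF _ Suc.IH[OF f'(2) Suc.prems(2)]])
qed

lemma Ck_on_const: "Ck_on k S (\<lambda>x. c)"
proof (induction k arbitrary: c)
  case (Suc k)
  show ?case by (rule Ck_on_SucI[of _ _ "\<lambda>x h. 0"]) (auto intro: Suc)
qed simp

lemma Ck_on_bounded_linear: "bounded_linear f \<Longrightarrow> Ck_on k S f"
proof (cases k)
  case 0
  then show "bounded_linear f \<Longrightarrow> ?thesis" by (simp add: linear_continuous_on)
next
  case (Suc l)
  show "bounded_linear f \<Longrightarrow> ?thesis"
    unfolding Suc
    by (rule Ck_on_SucI[of _ _ "\<lambda>x. f"]) (auto intro: Ck_on_const bounded_linear_imp_has_derivative)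
qed

lemma Ck_on_add:
  "Ck_on k S f \<Longrightarrow> Ck_on k S g \<Longrightarrow> Ck_on k S (\<lambda>x. f x + g x)"
proof (induction k arbitrary: f g)
  case 0
  then show ?case by (auto intro: continuous_intros)
next
  case (Suc k)
  then obtain f' g' where f': "\<And>x. x \<in> S \<Longrightarrow> (f has_derivative f' x) (at x within S)"
    "\<And>h. Ck_on k S (\<lambda>x. f' x h)" and
    g': "\<And>x. x \<in> S \<Longrightarrow> (g has_derivative g' x) (at x within S)"
    "\<And>h. Ck_on k S (\<lambda>x. g' x h)" unfolding Ck_on.simps(2) by metis
  show ?case
    by (rule Ck_on_SucI[OF has_derivative_add[OF f'(1) g'(1)] Suc.IH[OF f'(2) g'(2)]])
qed

lemma Ck_on_mult:
  "Ck_on k S f \<Longrightarrow> Ck_on k S g \<Longrightarrow> Ck_on k S (\<lambda>x. f x * g x)"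
proof (induction k arbitrary: f g)
  case 0
  then show ?case by (auto intro: continuous_intros)
next
  case (Suc k)
  then obtain f' g' where f': "\<And>x. x \<in> S \<Longrightarrow> (f has_derivative f' x) (at x within S)"
    "\<And>h. Ck_on k S (\<lambda>x. f' x h)" and
    g': "\<And>x. x \<in> S \<Longrightarrow> (g has_derivative g' x) (at x within S)"
    "\<And>h. Ck_on k S (\<lambda>x. g' x h)" unfolding Ck_on.simps(2) by metis
  have c: "Ck_on k S (\<lambda>x. f x * g' x h + f' x h * g x)" for h
    by (intro Ck_on_add Suc.IH f'(2) g'(2) Suc.prems[THEN Ck_on_Suc_D])
  show ?case
    by (rule Ck_on_SucI[OF has_derivative_mult[OF f'(1) g'(1)] c])
qed

lemma Ck_on_exp: "Ck_on k S f \<Longrightarrow> Ck_on k S (\<lambda>x. exp (f x))"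
proof (induction k arbitrary: f)
  case 0
  then show ?case by (auto intro: continuous_intros)
next
  case (Suc k)
  then obtain f' where f': "\<And>x. x \<in> S \<Longrightarrow> (f has_derivative f' x) (at x within S)"
    "\<And>h. Ck_on k S (\<lambda>x. f' x h)" by (elim Ck_on_SucE) blast
  have c: "Ck_on k S (\<lambda>x. f' x h * exp (f x))" for h
    by (intro Ck_on_mult Suc.IH f'(2) Suc.prems[THEN Ck_on_Suc_D])
  show ?case
    by (rule Ck_on_SucI[OF has_derivative_exp[OF f'(1)] c])
qed

text \<open>Differentiation exchanges the two functions up to sign, so they share one
  induction.\<close>

lemma Ck_on_sin_cos:
  "Ck_on k S f \<Longrightarrow> Ck_on k S (\<lambda>x. sin (f x)) \<and> Ck_on k S (\<lambda>x. cos (f x))"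
proof (induction k arbitrary: f)
  case 0
  then show ?case by (auto intro: continuous_intros)
next
  case (Suc k)
  then obtain f' where f': "\<And>x. x \<in> S \<Longrightarrow> (f has_derivative f' x) (at x within S)"
    "\<And>h. Ck_on k S (\<lambda>x. f' x h)" by (elim Ck_on_SucE) blast
  have IH: "Ck_on k S (\<lambda>x. sin (f x))" "Ck_on k S (\<lambda>x. cos (f x))"
    using Suc.IH[OF Ck_on_Suc_D[OF Suc.prems]] by auto
  have "Ck_on k S (\<lambda>x. f' x h * cos (f x))" "Ck_on k S (\<lambda>x. f' x h * - sin (f x))" for h
    using Ck_on_mult[OF f'(2) IH(2)] Ck_on_mult[OF f'(2) Ck_on_mult[OF Ck_on_const[of _ _ "-1"] IH(1)]]
    by auto
  then show ?case
    using Ck_on_SucI[OF has_derivative_sin[OF f'(1)]] Ck_on_SucI[OF has_derivative_cos[OF f'(1)]]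
    by blast
qed

lemma Ck_on_inverse:
  "Ck_on k S f \<Longrightarrow> (\<And>x. x \<in> S \<Longrightarrow> f x \<noteq> 0) \<Longrightarrow> Ck_on k S (\<lambda>x. inverse (f x))"
proof (induction k arbitrary: f)
  case 0
  then show ?case by (auto intro: continuous_intros)
next
  case (Suc k)
  then obtain f' where f': "\<And>x. x \<in> S \<Longrightarrow> (f has_derivative f' x) (at x within S)"
    "\<And>h. Ck_on k S (\<lambda>x. f' x h)" by (elim Ck_on_SucE) blast
  have IH: "Ck_on k S (\<lambda>x. inverse (f x))"
    by (rule Suc.IH[OF Ck_on_Suc_D[OF Suc.prems(1)] Suc.prems(2)])
  have "Ck_on k S (\<lambda>x. -1 * (inverse (f x) * f' x h * inverse (f x)))" for h
    by (intro Ck_on_mult Ck_on_const IH f'(2))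
  then have c: "Ck_on k S (\<lambda>x. - (inverse (f x) * f' x h * inverse (f x)))" for h by simp
  show ?case
    by (rule Ck_on_SucI[OF Deriv.has_derivative_inverse[OF Suc.prems(2) f'(1)] c])
qed

text \<open>One differentiation leads from the logarithm to \<open>inverse\<close>, where the
  induction has already been done.\<close>

lemma Ck_on_ln:
  assumes f: "Ck_on k S f" and pos: "\<And>x. x \<in> S \<Longrightarrow> 0 < f x"
  shows "Ck_on k S (\<lambda>x. ln (f x))"
proof -
  have nz: "f x \<noteq> 0" if "x \<in> S" for x using pos[OF that] by simp
  show ?thesis
  proof (cases k)
    case 0
    have "continuous_on S (\<lambda>x. ln (f x))"
      using Ck_on_continuous[OF f] nz by (intro continuous_on_ln) blast+
    then show ?thesis by (simp add: 0)
  next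
    case (Suc l)
    obtain f' where f': "\<And>x. x \<in> S \<Longrightarrow> (f has_derivative f' x) (at x within S)"
      "\<And>h. Ck_on l S (\<lambda>x. f' x h)" using f[unfolded Suc] by (rule Ck_on_SucE) blast
    have "Ck_on l S (\<lambda>x. inverse (f x))"
      by (rule Ck_on_inverse[OF f[unfolded Suc, THEN Ck_on_Suc_D] nz])
    then have c: "Ck_on l S (\<lambda>x. f' x h * inverse (f x))" for h
      by (intro Ck_on_mult f'(2))
    show ?thesis
      unfolding Suc by (rule Ck_on_SucI[OF has_derivative_ln[OF pos f'(1)] c])
  qed
qed

text \<open>Smoothness passes to slices through the directions \<open>(0, h)\<close>. A slice stays
  inside \<open>T \<times> UNIV\<close>, so boundary points \<open>t\<close> of \<open>T\<close> are
  covered too.\<close>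

lemma Ck_on_slice:
  fixes F :: "'a::euclidean_space \<times> 'b::euclidean_space \<Rightarrow> real"
  shows "Ck_on k (T \<times> UNIV) F \<Longrightarrow> t \<in> T \<Longrightarrow> Ck_on k UNIV (\<lambda>x. F (t, x))"
proof (induction k arbitrary: F)
  case 0
  then show ?case by (auto intro!: continuous_on_compose2[of "T \<times> UNIV" F] continuous_intros)
next
  case (Suc k)
  then obtain F' where F': "\<And>p. p \<in> T \<times> UNIV \<Longrightarrow> (F has_derivative F' p) (at p within T \<times> UNIV)"
    "\<And>h. Ck_on k (T \<times> UNIV) (\<lambda>p. F' p h)" by auto
  have "((\<lambda>x. F (t, x)) has_derivative (\<lambda>h. F' (t, x) (0, h))) (at x)" for x
  proof (rule has_derivative_in_compose2[of "T \<times> UNIV" F F' _ UNIV])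
    show "((\<lambda>x. (t, x)) has_derivative (\<lambda>h. (0, h))) (at x)"
      by (auto intro!: derivative_eq_intros)
  qed (use F' Suc.prems in auto)
  moreover have "Ck_on k UNIV (\<lambda>x. F' (t, x) (0, h))" for h
    using Suc.IH[OF F'(2) Suc.prems(2)] .
  ultimately show ?case by (rule Ck_on_SucI)
qed

text \<open>The induction runs over all \<rho>, since a derivative of the convolution is the
  convolution of a derivative.\<close>

lemma Ck_on_torus_conv:
  assumes W: "interaction_kernel W"
  shows "Ck_on k UNIV \<rho> \<Longrightarrow> torus_fun \<rho> \<Longrightarrow> Ck_on k UNIV (torus_conv W \<rho>)"
proof (induction k arbitrary: \<rho>)
  case 0
  then show ?case using torus_conv_continuous[OF W] by simp
next
  case (Suc k)
  then obtain \<rho>' where \<rho>': "\<And>x. (\<rho> has_derivative \<rho>' x) (at x)"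
    "\<And>h. Ck_on k UNIV (\<lambda>x. \<rho>' x h)" by auto
  have c: "Ck_on k UNIV (\<lambda>x. torus_conv W (\<lambda>y. \<rho>' y h) x)" for h
    using Suc.IH[OF \<rho>'(2) torus_fun_derivative[OF Suc.prems(2) \<rho>'(1)]] by simp
  have d: "(torus_conv W \<rho> has_derivative (\<lambda>h. torus_conv W (\<lambda>y. \<rho>' y h) x)) (at x)" for x
    using torus_conv_has_derivative[OF W Suc.prems(2) \<rho>'(1)] Ck_on_continuous \<rho>'(2) by blast
  show ?case by (rule Ck_on_SucI[OF d c])
qed

section \<open>Smooth functions on the torus\<close>

lemma torus_smoothI: "torus_fun f \<Longrightarrow> (\<And>k. Ck_on k UNIV f) \<Longrightarrow> torus_smooth f"
  and torus_smooth_torus_fun: "torus_smooth f \<Longrightarrow> torus_fun f"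
  and torus_smooth_Ck_on: "torus_smooth f \<Longrightarrow> Ck_on k UNIV f"
  by (auto simp: torus_smooth_def smooth_on_def)

lemma torus_smooth_continuous: "torus_smooth f \<Longrightarrow> continuous_on UNIV f"
  using torus_smooth_Ck_on[of f 0] by simp

lemma torus_smooth_has_derivative:
  assumes "torus_smooth f"
  shows "(f has_derivative frechet_derivative f (at x)) (at x)"
proof -
  obtain f' where "\<And>x. (f has_derivative f' x) (at x)"
    using torus_smooth_Ck_on[OF assms, of 1] by auto
  then show ?thesis unfolding frechet_derivative_works[symmetric] differentiable_def by blast
qed

lemma torus_smooth_partial_deriv:
  assumes f: "torus_smooth f"
  shows "torus_smooth (partial_deriv i f)"
proof (rule torus_smoothI)
  show "torus_fun (partial_deriv i f)"
    unfolding partial_deriv_def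
    by (rule torus_fun_derivative[OF torus_smooth_torus_fun[OF f] torus_smooth_has_derivative[OF f]])
  fix k
  obtain f' where f': "\<And>x. (f has_derivative f' x) (at x)" "\<And>h. Ck_on k UNIV (\<lambda>x. f' x h)"
    using torus_smooth_Ck_on[OF f, of "Suc k"] by auto
  have "frechet_derivative f (at x) = f' x" for x
    using f'(1) frechet_derivative_at by metis
  then have "partial_deriv i f = (\<lambda>x. f' x (axis i 1))"
    by (simp add: partial_deriv_def fun_eq_iff)
  then show "Ck_on k UNIV (partial_deriv i f)"
    using f'(2) by simp
qed

lemma torus_smooth_const: "torus_smooth (\<lambda>x. c)"
  and torus_smooth_add: "torus_smooth f \<Longrightarrow> torus_smooth g \<Longrightarrow> torus_smooth (\<lambda>x. f x + g x)"
  and torus_smooth_mult: "torus_smooth f \<Longrightarrow> torus_smooth g \<Longrightarrow> torus_smooth (\<lambda>x. f x * g x)"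
  and torus_smooth_exp: "torus_smooth f \<Longrightarrow> torus_smooth (\<lambda>x. exp (f x))"
  and torus_smooth_ln: "torus_smooth f \<Longrightarrow> (\<And>x. 0 < f x) \<Longrightarrow> torus_smooth (\<lambda>x. ln (f x))"
  by (simp_all add: torus_smooth_def smooth_on_def torus_fun_def Ck_on_const Ck_on_add Ck_on_mult
      Ck_on_exp Ck_on_ln)

lemma torus_smooth_sum:
  "(\<And>i. i \<in> A \<Longrightarrow> torus_smooth (f i)) \<Longrightarrow> torus_smooth (\<lambda>x. \<Sum>i\<in>A. f i x)"
  by (induction A rule: infinite_finite_induct) (auto intro: torus_smooth_const torus_smooth_add)

lemma torus_smooth_torus_conv:
  "interaction_kernel W \<Longrightarrow> torus_smooth \<rho> \<Longrightarrow> torus_smooth (torus_conv W \<rho>)"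
  by (intro torus_smoothI Ck_on_torus_conv torus_conv_torus_fun)
    (auto simp: torus_smooth_torus_fun torus_smooth_Ck_on torus_smooth_continuous)

subsection \<open>Smooth test functions separate continuous functions\<close>

lemma integrable_unit_cell_continuous:
  fixes f :: "real^'d \<Rightarrow> real"
  assumes "continuous_on UNIV f"
  shows "integrable unit_cell f"
proof -
  have "compact (f ` cbox 0 1)"
    by (rule compact_continuous_image) (use assms continuous_on_subset in auto)
  then obtain C where "\<And>y. y \<in> f ` cbox 0 1 \<Longrightarrow> norm y \<le> C"
    by (meson bounded_iff compact_imp_bounded)
  then show ?thesis
    using assms by (intro integrable_unit_cell[of f C] borel_measurable_continuous_onI) auto
qed

text \<open>The torus as a product of unit circles, all cosines in the first component and all sines
  in the second. Polynomials on the target pull back to trigonometric polynomials.\<close>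

definition torus_embed :: "real^'d \<Rightarrow> (real^'d) \<times> (real^'d)" where
  "torus_embed x = ((\<chi> i. cos (2 * pi * x $ i)), (\<chi> i. sin (2 * pi * x $ i)))"

lemma torus_embed_eq_iff: "torus_embed x = torus_embed y \<longleftrightarrow> x - y \<in> int_lattice"
proof -
  have "cos (2 * pi * x $ i) = cos (2 * pi * y $ i) \<and> sin (2 * pi * x $ i) = sin (2 * pi * y $ i)
      \<longleftrightarrow> x $ i - y $ i \<in> \<int>" for i
  proof -
    have "(2 * pi * x $ i = 2 * pi * y $ i + 2 * pi * of_int n) \<longleftrightarrow> (x $ i - y $ i = of_int n)" for n
    proof -
      have "2 * pi * y $ i + 2 * pi * of_int n = 2 * pi * (y $ i + of_int n)" by (simp add: distrib_left)
      then show ?thesis by auto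
    qed
    then have "(sin (2 * pi * x $ i) = sin (2 * pi * y $ i) \<and> cos (2 * pi * x $ i) = cos (2 * pi * y $ i))
        \<longleftrightarrow> (\<exists>n::int. x $ i - y $ i = of_int n)"
      by (simp only: sin_cos_eq_iff)
    also have "\<dots> \<longleftrightarrow> x $ i - y $ i \<in> \<int>"
      by (auto elim: Ints_cases)
    finally show ?thesis by blast
  qed
  then show ?thesis
    by (auto simp: torus_embed_def int_lattice_def vec_eq_iff)
qed

lemma continuous_on_torus_embed: "continuous_on S torus_embed"
  unfolding torus_embed_def by (intro continuous_intros)

lemma torus_smooth_cos_sin:
  "torus_smooth (\<lambda>x. cos (2 * pi * x $ i))" "torus_smooth (\<lambda>x. sin (2 * pi * x $ i))"
proof -
  have per: "torus_embed (x + k) = torus_embed x" if "k \<in> int_lattice" for x k :: "real^'a"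
    using that by (simp add: torus_embed_eq_iff)
  have "torus_fun (\<lambda>x. cos (2 * pi * x $ i))" "torus_fun (\<lambda>x. sin (2 * pi * x $ i))"
    using per unfolding torus_fun_def torus_embed_def by (auto simp: vec_eq_iff)
  moreover have "bounded_linear (\<lambda>x::real^'a. 2 * pi * x $ i)"
    by (intro bounded_linear_const_mult bounded_linear_vec_nth)
  ultimately show "torus_smooth (\<lambda>x. cos (2 * pi * x $ i))" "torus_smooth (\<lambda>x. sin (2 * pi * x $ i))"
    using Ck_on_sin_cos[OF Ck_on_bounded_linear] by (auto intro!: torus_smoothI)
qed

lemma torus_smooth_polynomial_embed:
  fixes p :: "(real^'d) \<times> (real^'d) \<Rightarrow> real"
  assumes "real_polynomial_function p"
  shows "torus_smooth (\<lambda>x. p (torus_embed x))"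
  using assms
proof (induction p rule: real_polynomial_function.induct)
  case (linear f)
  interpret f: bounded_linear f by fact
  \<comment> \<open>A linear functional is determined by its values on the coordinate directions, so
    it pulls back to a combination of cosines and sines.\<close>
  have f_eq: "f (a, b) = (\<Sum>i\<in>UNIV. a $ i * f (axis i 1, 0)) + (\<Sum>i\<in>UNIV. b $ i * f (0, axis i 1))" for a b
  proof -
    have "(a, b) = (\<Sum>i\<in>UNIV. a $ i *\<^sub>R (axis i 1, 0)) + (\<Sum>i\<in>UNIV. b $ i *\<^sub>R (0, axis i 1))"
      using basis_expansion[of a] basis_expansion[of b]
      by (simp add: prod_eq_iff fst_sum snd_sum scalar_mult_eq_scaleR)
    then have "f (a, b) = f ((\<Sum>i\<in>UNIV. a $ i *\<^sub>R (axis i 1, 0)) + (\<Sum>i\<in>UNIV. b $ i *\<^sub>R (0, axis i 1)))"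
      by (rule arg_cong)
    then show ?thesis by (simp only: f.add f.sum f.scaleR real_scaleR_def)
  qed
  have "f (torus_embed x) = (\<Sum>i\<in>UNIV. cos (2 * pi * x $ i) * f (axis i 1, 0)) +
      (\<Sum>i\<in>UNIV. sin (2 * pi * x $ i) * f (0, axis i 1))" for x
    unfolding torus_embed_def f_eq[of "vec_lambda _" "vec_lambda _"] by simp
  then show ?case
    by (simp only:) (intro torus_smooth_add torus_smooth_sum torus_smooth_mult torus_smooth_cos_sin
        torus_smooth_const)
qed (auto intro: torus_smooth_const torus_smooth_add torus_smooth_mult)

text \<open>A continuous function on the torus factors through the compact image of the torus under
  \<^const>\<open>torus_embed\<close>, on which the Stone--Weierstrass theorem applies.\<close>

lemma torus_smooth_dense:
  fixes f :: "real^'d \<Rightarrow> real"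
  assumes f: "torus_fun f" "continuous_on UNIV f" and e: "0 < e"
  obtains g where "torus_smooth g" "\<And>x. \<bar>f x - g x\<bar> < e"
proof -
  let ?K = "torus_embed ` cbox 0 (1 :: real^'d)"
  have K: "compact ?K"
    by (intro compact_continuous_image continuous_on_torus_embed) auto
  have fac: "f x = f y" if "torus_embed x = torus_embed y" for x y
  proof -
    have "x - y \<in> int_lattice" using that by (simp only: torus_embed_eq_iff)
    then have "f (y + (x - y)) = f y" using f(1) unfolding torus_fun_def by blast
    then show ?thesis by simp
  qed
  define h where "h p = f (SOME x. torus_embed x = p)" for p
  have h: "h (torus_embed x) = f x" for x
    unfolding h_def by (rule fac, rule someI) (rule refl)
  \<comment> \<open>The preimage of a closed set under \<open>h\<close> is the image of a compact
    set, hence closed; the choice made in \<open>h\<close> is harmless by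
    \<open>fac\<close>.\<close>
  have "continuous_on ?K h"
    unfolding continuous_on_closed_vimage[OF compact_imp_closed[OF K]]
  proof (intro allI impI)
    fix B :: "real set" assume B: "closed B"
    have "h -` B \<inter> ?K = torus_embed ` (cbox 0 1 \<inter> f -` B)"
      using h by force
    moreover have "compact (cbox 0 1 \<inter> f -` B)"
      using continuous_closed_vimage[OF B, of f] f(2)
      by (intro compact_Int_closed) (auto simp: continuous_on_eq_continuous_at)
    ultimately show "closed (h -` B \<inter> ?K)"
      by (auto intro!: compact_imp_closed compact_continuous_image continuous_on_torus_embed)
  qed
  then obtain p where p: "real_polynomial_function p" "\<And>y. y \<in> ?K \<Longrightarrow> \<bar>h y - p y\<bar> < e"
    using Stone_Weierstrass_real_polynomial_function[OF K _ e] by metis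
  have "\<bar>f x - p (torus_embed x)\<bar> < e" for x
  proof -
    have "torus_embed (frac_part x) = torus_embed x"
      using frac_part_lattice by (simp add: torus_embed_eq_iff)
    then have "torus_embed x \<in> ?K" using frac_part_in_cbox[of x] by (metis imageI)
    then show ?thesis using p(2)[of "torus_embed x"] by (simp only: h)
  qed
  then show ?thesis using that torus_smooth_polynomial_embed[OF p(1)] by blast
qed

text \<open>A continuous nonnegative integrand with zero integral vanishes on the box. The Lebesgue
  integral is turned into a gauge integral to apply this, and \<open>frac_part\<close> carries the
  zeros to all points.\<close>

lemma torus_integral_square_eq_0:
  fixes f :: "real^'d \<Rightarrow> real"
  assumes f: "torus_fun f" "continuous_on UNIV f" and z: "torus_integral (\<lambda>x. (f x)\<^sup>2) = 0"
  shows "f x = 0"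
proof -
  have c: "continuous_on UNIV (\<lambda>x. (f x)\<^sup>2)" by (intro continuous_intros f)
  have "set_integrable lborel (cbox 0 1) (\<lambda>x. (f x)\<^sup>2)"
    unfolding set_integrable_def by (subst integrable_restrict_space[symmetric])
      (auto intro: integrable_unit_cell_continuous[OF c])
  then have "((\<lambda>x. (f x)\<^sup>2) has_integral 0) (cbox 0 1)"
    using z unfolding torus_integral_def
    by (metis set_borel_integral_eq_integral integrable_integral)
  then have "(f y)\<^sup>2 = 0" if "y \<in> cbox 0 1" for y
    using has_integral_0_cbox_imp_0[of 0 "1::real^'d" "\<lambda>x. (f x)\<^sup>2" y] that c
    by (auto intro: continuous_on_subset simp: interval_ne_empty_cart)
  then show ?thesis
    using frac_part_in_cbox torus_fun_frac_part[OF f(1), of x] by (metis power_eq_0_iff)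
qed

text \<open>The natural test function is \<open>f\<close> itself, but it is only continuous. With a
  uniformly close smooth \<open>g\<close>, the square of \<open>f\<close> splits into
  \<open>f * g\<close>, whose integral is 0, and the small term \<open>f * (f - g)\<close>.\<close>

lemma smooth_test_functions_separate:
  fixes f :: "real^'d \<Rightarrow> real"
  assumes f: "torus_fun f" "continuous_on UNIV f"
    and z: "\<And>g. torus_smooth g \<Longrightarrow> torus_integral (\<lambda>x. f x * g x) = 0"
  shows "f x = 0"
proof (rule torus_integral_square_eq_0[OF f])
  obtain C where C: "\<And>x. \<bar>f x\<bar> \<le> C" using torus_fun_bounded[OF f] by blast
  interpret finite_measure "unit_cell :: (real^'d) measure" by (rule finite_measure_unit_cell)
  let ?m = "measure (unit_cell :: (real^'d) measure) (cbox 0 1)"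
  have "torus_integral (\<lambda>x. (f x)\<^sup>2) \<le> 0"
  proof (rule field_le_epsilon)
    fix e :: real assume e: "0 < e"
    \<comment> \<open>Chosen so that the error term is at most \<open>e\<close>; the summand 1 keeps
      the denominator positive even if \<open>C = 0\<close>.\<close>
    define d where "d = e / (\<bar>C\<bar> * ?m + 1)"
    have d: "0 < d" unfolding d_def using e by (intro divide_pos_pos add_nonneg_pos) auto
    obtain g where g: "torus_smooth g" "\<And>x. \<bar>f x - g x\<bar> < d"
      using torus_smooth_dense[OF f d] by blast
    have cg: "continuous_on UNIV g" by (rule torus_smooth_continuous[OF g(1)])
    have int: "integrable unit_cell (\<lambda>x. f x * g x)" "integrable unit_cell (\<lambda>x. f x * (f x - g x))"
      by (intro integrable_unit_cell_continuous continuous_intros f cg)+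
    have "torus_integral (\<lambda>x. (f x)\<^sup>2) = (\<integral>x. f x * g x + f x * (f x - g x) \<partial>unit_cell)"
      by (simp add: torus_integral_eq power2_eq_square algebra_simps)
    also have "\<dots> = torus_integral (\<lambda>x. f x * g x) + (\<integral>x. f x * (f x - g x) \<partial>unit_cell)"
      using int by (simp only: Bochner_Integration.integral_add torus_integral_eq)
    also have "\<dots> \<le> (\<integral>x. \<bar>C\<bar> * d \<partial>(unit_cell :: (real^'d) measure))"
    proof -
      have "f x * (f x - g x) \<le> \<bar>C\<bar> * d" for x
      proof -
        have "f x * (f x - g x) \<le> \<bar>f x\<bar> * \<bar>f x - g x\<bar>"
          by (metis abs_ge_self abs_mult)
        also have "\<dots> \<le> \<bar>C\<bar> * d"
          using C[of x] g(2)[of x] by (intro mult_mono) auto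
        finally show ?thesis .
      qed
      then have "(\<integral>x. f x * (f x - g x) \<partial>unit_cell) \<le> (\<integral>x. \<bar>C\<bar> * d \<partial>(unit_cell :: (real^'d) measure))"
        by (intro integral_mono int(2)) auto
      then show ?thesis using z[OF g(1)] by linarith
    qed
    also have "\<dots> = \<bar>C\<bar> * ?m * d" by simp
    also have "\<dots> \<le> (\<bar>C\<bar> * ?m + 1) * d" using d by (intro mult_right_mono) auto
    also have "\<dots> = e"
    proof -
      have "\<bar>C\<bar> * ?m + 1 \<noteq> 0" 
        by (metis abs_ge_zero add_nonneg_pos less_irrefl measure_nonneg mult_nonneg_nonneg zero_less_one)
      then show ?thesis by (simp add: d_def)
    qed
    finally show "torus_integral (\<lambda>x. (f x)\<^sup>2) \<le> 0 + e" by simp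
  qed
  moreover have "0 \<le> torus_integral (\<lambda>x. (f x)\<^sup>2)"
    by (simp add: torus_integral_eq)
  ultimately show "torus_integral (\<lambda>x. (f x)\<^sup>2) = 0" by simp
qed

lemma has_first_variation_unique:
  assumes "has_first_variation F \<rho> \<phi>" "has_first_variation F \<rho> \<psi>"
  shows "\<phi> = \<psi>"
proof
  fix x
  have c: "continuous_on UNIV \<phi>" "continuous_on UNIV \<psi>"
    using assms by (simp_all add: has_first_variation_def)
  have "\<phi> x - \<psi> x = 0"
  proof (rule smooth_test_functions_separate)
    show "torus_fun (\<lambda>x. \<phi> x - \<psi> x)"
      using assms by (simp add: has_first_variation_def torus_fun_def)
    show "continuous_on UNIV (\<lambda>x. \<phi> x - \<psi> x)" by (intro continuous_intros c)
    fix g :: "real^'a \<Rightarrow> real" assume g: "torus_smooth g"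
    have "torus_integral (\<lambda>x. \<phi> x * g x) = torus_integral (\<lambda>x. \<psi> x * g x)"
      using assms g unfolding has_first_variation_def by (blast intro: DERIV_unique)
    moreover have "integrable unit_cell (\<lambda>x. \<phi> x * g x)" "integrable unit_cell (\<lambda>x. \<psi> x * g x)"
      by (intro integrable_unit_cell_continuous continuous_intros c torus_smooth_continuous[OF g])+
    ultimately show "torus_integral (\<lambda>x. (\<phi> x - \<psi> x) * g x) = 0"
      by (simp add: torus_integral_eq left_diff_distrib)
  qed
  then show "\<phi> x = \<psi> x" by simp
qed

subsection \<open>The free energy along a curve of densities\<close>

lemma torus_integral_bound:
  fixes f :: "real^'d \<Rightarrow> real"
  assumes "f \<in> borel_measurable borel" "\<And>x. \<bar>f x\<bar> \<le> C"
  shows "\<bar>torus_integral f\<bar> \<le> C * measure (unit_cell :: (real^'d) measure) (cbox 0 1)"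
proof -
  interpret finite_measure "unit_cell :: (real^'d) measure" by (rule finite_measure_unit_cell)
  have "\<bar>\<integral>x. f x \<partial>unit_cell\<bar> \<le> (\<integral>x. \<bar>f x\<bar> \<partial>unit_cell)"
    using integral_norm_bound[of unit_cell f] by simp
  also have "\<dots> \<le> (\<integral>x. C \<partial>(unit_cell :: (real^'d) measure))"
    using integrable_unit_cell[of f C] assms by (intro integral_mono) auto
  finally show ?thesis by (simp add: torus_integral_eq mult.commute)
qed

text \<open>Fubini and the evenness of \<open>W\<close>: convolution with an even kernel is
  self-adjoint. All factors are bounded on a finite measure space, hence the double integral
  converges.\<close>

lemma torus_conv_symmetric:
  fixes W f g :: "real^'d \<Rightarrow> real"
  assumes W: "interaction_kernel W"
    and f: "torus_fun f" "continuous_on UNIV f" and g: "torus_fun g" "continuous_on UNIV g"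
  shows "torus_integral (\<lambda>x. f x * torus_conv W g x) = torus_integral (\<lambda>x. g x * torus_conv W f x)"
proof -
  obtain B where B: "B \<ge> 0" "\<And>x. \<bar>W x\<bar> \<le> B" using kernel_bounded[OF W] by blast
  obtain C where C: "\<And>x. \<bar>f x\<bar> \<le> C" using torus_fun_bounded[OF f] by blast
  obtain D where D: "\<And>x. \<bar>g x\<bar> \<le> D" using torus_fun_bounded[OF g] by blast
  have [measurable]: "W \<in> borel_measurable borel" "f \<in> borel_measurable borel" "g \<in> borel_measurable borel"
    using kernel_measurable[OF W] f(2) g(2) by (auto intro: borel_measurable_continuous_onI)
  let ?M = "unit_cell :: (real^'d) measure"
  interpret M: finite_measure ?M by (rule finite_measure_unit_cell)
  interpret P: pair_sigma_finite ?M ?M by unfold_locales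
  interpret MM: finite_measure "?M \<Otimes>\<^sub>M ?M"
    by (rule finite_measure_pair_measure) (rule finite_measure_unit_cell)+
  have id: "(\<lambda>x. x) \<in> borel_measurable ?M" by (rule measurable_unit_cell) simp
  have [measurable]: "fst \<in> borel_measurable (?M \<Otimes>\<^sub>M ?M)" "snd \<in> borel_measurable (?M \<Otimes>\<^sub>M ?M)"
    using measurable_compose[OF measurable_fst id, of ?M] measurable_compose[OF measurable_snd id, of ?M]
    by simp_all
  have int: "integrable (?M \<Otimes>\<^sub>M ?M) (\<lambda>(x, y). f x * (W (x - y) * g y))"
  proof (rule MM.integrable_const_bound)
    show "AE p in ?M \<Otimes>\<^sub>M ?M. norm (case p of (x, y) \<Rightarrow> f x * (W (x - y) * g y)) \<le> C * (B * D)"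
      using B C D order_trans[OF abs_ge_zero C]
      by (auto simp: abs_mult split: prod.split intro!: AE_I2 mult_mono)
    show "(\<lambda>(x, y). f x * (W (x - y) * g y)) \<in> borel_measurable (?M \<Otimes>\<^sub>M ?M)"
      unfolding split_beta' by measurable
  qed
  have "(\<integral>x. f x * (\<integral>y. W (x - y) * g y \<partial>?M) \<partial>?M) = (\<integral>x. \<integral>y. f x * (W (x - y) * g y) \<partial>?M \<partial>?M)"
    by simp
  also have "\<dots> = (\<integral>y. \<integral>x. f x * (W (x - y) * g y) \<partial>?M \<partial>?M)"
    by (rule P.Fubini_integral[OF int, symmetric])
  also have "\<dots> = (\<integral>y. g y * (\<integral>x. W (y - x) * f x \<partial>?M) \<partial>?M)"
  proof (rule Bochner_Integration.integral_cong[OF refl])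
    fix y
    have "(\<integral>x. f x * (W (x - y) * g y) \<partial>?M) = (\<integral>x. g y * (W (y - x) * f x) \<partial>?M)"
      using kernel_even[OF W] by (metis (no_types, lifting) minus_diff_eq mult.assoc mult.commute)
    then show "(\<integral>x. f x * (W (x - y) * g y) \<partial>?M) = g y * (\<integral>x. W (y - x) * f x \<partial>?M)" by simp
  qed
  finally show ?thesis by (simp add: torus_conv_def torus_integral_eq)
qed

text \<open>By periodicity it suffices to look at \<open>T\<close> times the cell, which is compact.
  Dominated convergence later needs these bounds uniformly in time.\<close>

lemma family_bounded:
  fixes f :: "'a::metric_space \<Rightarrow> real^'d \<Rightarrow> real"
  assumes T: "compact T" and f: "continuous_on (T \<times> UNIV) (\<lambda>p. f (fst p) (snd p))"
    and per: "\<And>t. t \<in> T \<Longrightarrow> torus_fun (f t)"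
  obtains C where "\<And>t x. t \<in> T \<Longrightarrow> \<bar>f t x\<bar> \<le> C"
proof -
  have "compact ((\<lambda>p. f (fst p) (snd p)) ` (T \<times> cbox 0 1))"
    by (intro compact_continuous_image compact_Times T continuous_on_subset[OF f]) auto
  then obtain C where C: "\<And>y. y \<in> (\<lambda>p. f (fst p) (snd p)) ` (T \<times> cbox 0 1) \<Longrightarrow> norm y \<le> C"
    by (meson bounded_iff compact_imp_bounded)
  have "\<bar>f t x\<bar> \<le> C" if "t \<in> T" for t x
  proof -
    have "f t (frac_part x) \<in> (\<lambda>p. f (fst p) (snd p)) ` (T \<times> cbox 0 1)"
      using that frac_part_in_cbox by (intro image_eqI[of _ _ "(t, frac_part x)"]) auto
    then show ?thesis using C torus_fun_frac_part[OF per[OF that], of x] by force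
  qed
  then show ?thesis using that by blast
qed

text \<open>A chain rule along curves with velocity \<open>v\<close> that serves twice: for the
  affine perturbations defining the first variation and for solutions in time. Derivatives within
  \<open>T\<close> keep it valid at the endpoints of a time interval.\<close>

lemma free_energy_has_real_derivative:
  fixes u v :: "real \<Rightarrow> real^'d \<Rightarrow> real"
  assumes W: "interaction_kernel W" and T: "convex T" "compact T" "t0 \<in> T"
    and u: "continuous_on (T \<times> UNIV) (\<lambda>p. u (fst p) (snd p))" "\<And>t. t \<in> T \<Longrightarrow> torus_fun (u t)"
    and v: "continuous_on (T \<times> UNIV) (\<lambda>p. v (fst p) (snd p))" "\<And>t. t \<in> T \<Longrightarrow> torus_fun (v t)"
    and pos: "\<And>t x. t \<in> T \<Longrightarrow> 0 < u t x"
    and deriv: "\<And>t x. t \<in> T \<Longrightarrow> ((\<lambda>t. u t x) has_real_derivative v t x) (at t within T)"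
  shows "((\<lambda>t. free_energy \<beta> W (u t)) has_real_derivative
      torus_integral (\<lambda>x. (ln (u t0 x) - 2 * \<beta> * torus_conv W (u t0) x) * v t0 x)) (at t0 within T)"
proof -
  let ?m = "measure (unit_cell :: (real^'d) measure) (cbox 0 1)"
  obtain B where B: "B \<ge> 0" "\<And>x. \<bar>W x\<bar> \<le> B" using kernel_bounded[OF W] by blast
  obtain U where U: "\<And>t x. t \<in> T \<Longrightarrow> \<bar>u t x\<bar> \<le> U" using family_bounded[OF T(2) u] by blast
  obtain V where V: "\<And>t x. t \<in> T \<Longrightarrow> \<bar>v t x\<bar> \<le> V" using family_bounded[OF T(2) v] by blast
  have nn: "0 \<le> U" "0 \<le> V" using U[OF T(3), of 0] V[OF T(3), of 0] by linarith+
  \<comment> \<open>Positivity makes \<open>ln u\<close> continuous and compactness then bounds it,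
    which implicitly keeps \<open>u\<close> away from 0.\<close>
  have "continuous_on (T \<times> UNIV) (\<lambda>p. ln (u (fst p) (snd p)))"
    using pos by (intro continuous_on_ln u) (auto simp: less_imp_neq[symmetric])
  moreover have "torus_fun (\<lambda>x. ln (u t x))" if "t \<in> T" for t
    using u(2)[OF that] by (simp add: torus_fun_def)
  ultimately obtain L where L: "\<And>t x. t \<in> T \<Longrightarrow> \<bar>ln (u t x)\<bar> \<le> L"
    using family_bounded[OF T(2), of "\<lambda>t x. ln (u t x)"] by blast
  have cu: "continuous_on UNIV (u t)" and cv: "continuous_on UNIV (v t)" if "t \<in> T" for t
  proof -
    have "continuous_on UNIV (Pair t :: real^'d \<Rightarrow> _)" by (intro continuous_intros)
    then show "continuous_on UNIV (u t)" "continuous_on UNIV (v t)"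
      using that continuous_on_compose2[OF u(1), of UNIV "Pair t"] continuous_on_compose2[OF v(1), of UNIV "Pair t"]
      by auto
  qed
  have cln: "continuous_on UNIV (\<lambda>x. ln (u t x))" if "t \<in> T" for t
    using pos[OF that] by (intro continuous_on_ln cu that) (metis less_irrefl)
  note cconv = torus_conv_continuous[OF W u(2) cu] torus_conv_continuous[OF W v(2) cv]
  have [measurable]: "W \<in> borel_measurable borel" by (rule kernel_measurable[OF W])
  have Wm: "(\<lambda>y. W (x - y) * g y) \<in> borel_measurable borel" if "continuous_on UNIV g" for g x
    using borel_measurable_continuous_onI[OF that] by measurable

  \<comment> \<open>The -1 in the entropy density cancels the derivative of the logarithm, leaving
    \<open>ln u\<close>.\<close>
  have entropy: "((\<lambda>t. \<integral>x. u t x * (ln (u t x) - 1) \<partial>unit_cell) has_real_derivative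
      (\<integral>x. v t0 x * ln (u t0 x) \<partial>unit_cell)) (at t0 within T)"
  proof (rule integral_has_real_derivative[OF finite_measure_unit_cell T(1,3), where C = "V * L"])
    fix t x assume t: "t \<in> T"
    show "((\<lambda>t. u t x * (ln (u t x) - 1)) has_real_derivative v t x * ln (u t x)) (at t within T)"
      using pos[OF t, of x] by (auto intro!: derivative_eq_intros deriv[OF t] simp: field_simps)
    show "\<bar>v t x * ln (u t x)\<bar> \<le> V * L"
      using V[OF t] L[OF t] nn by (auto simp: abs_mult intro!: mult_mono)
  next
    fix t assume "t \<in> T"
    then show "integrable unit_cell (\<lambda>x. u t x * (ln (u t x) - 1))"
      by (intro integrable_unit_cell_continuous continuous_intros cu cln)
  next
    show "(\<lambda>x. v t0 x * ln (u t0 x)) \<in> borel_measurable unit_cell"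
      by (intro borel_measurable_integrable integrable_unit_cell_continuous continuous_intros cv cln T)
  qed

  \<comment> \<open>The parameter is now time, which does not enter \<open>W\<close>, so the
    convolution can be differentiated in its original form.\<close>
  have conv_deriv: "((\<lambda>t. torus_conv W (u t) x) has_real_derivative torus_conv W (v t) x) (at t within T)"
    if t: "t \<in> T" for t x
    unfolding torus_conv_def torus_integral_eq
  proof (rule integral_has_real_derivative[OF finite_measure_unit_cell T(1) t, where C = "B * V"])
    fix s y assume s: "s \<in> T"
    show "((\<lambda>t. W (x - y) * u t y) has_real_derivative W (x - y) * v s y) (at s within T)"
      by (rule DERIV_cmult[OF deriv[OF s]])
    show "\<bar>W (x - y) * v s y\<bar> \<le> B * V"
      using B V[OF s] by (auto simp: abs_mult intro!: mult_mono)
  next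
    fix s assume s: "s \<in> T"
    show "integrable unit_cell (\<lambda>y. W (x - y) * u s y)"
      by (rule integrable_unit_cell[OF Wm[OF cu[OF s]], of _ "B * U"])
        (use B U[OF s] in \<open>auto simp: abs_mult intro!: mult_mono\<close>)
  next
    show "(\<lambda>y. W (x - y) * v t y) \<in> borel_measurable unit_cell"
      by (rule measurable_unit_cell[OF Wm[OF cv[OF t]]])
  qed
  have conv_bd: "\<bar>torus_conv W (u t) x\<bar> \<le> B * U * ?m" "\<bar>torus_conv W (v t) x\<bar> \<le> B * V * ?m"
    if t: "t \<in> T" for t x
    unfolding torus_conv_def
    using B U[OF t] V[OF t] cu[OF t] cv[OF t]
    by (auto simp: abs_mult intro!: torus_integral_bound Wm mult_mono)

  have inter: "((\<lambda>t. \<integral>x. u t x * torus_conv W (u t) x \<partial>unit_cell) has_real_derivative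
      (\<integral>x. v t0 x * torus_conv W (u t0) x + u t0 x * torus_conv W (v t0) x \<partial>unit_cell)) (at t0 within T)"
  proof (rule integral_has_real_derivative[OF finite_measure_unit_cell T(1,3),
        where C = "V * (B * U * ?m) + U * (B * V * ?m)"])
    fix t x assume t: "t \<in> T"
    show "((\<lambda>t. u t x * torus_conv W (u t) x) has_real_derivative
        v t x * torus_conv W (u t) x + u t x * torus_conv W (v t) x) (at t within T)"
      by (auto intro!: derivative_eq_intros deriv[OF t] conv_deriv[OF t])
    have "\<bar>v t x * torus_conv W (u t) x\<bar> \<le> V * (B * U * ?m)" "\<bar>u t x * torus_conv W (v t) x\<bar> \<le> U * (B * V * ?m)"
      unfolding abs_mult by (intro mult_mono U[OF t] V[OF t] conv_bd[OF t] nn abs_ge_zero)+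
    then show "\<bar>v t x * torus_conv W (u t) x + u t x * torus_conv W (v t) x\<bar>
        \<le> V * (B * U * ?m) + U * (B * V * ?m)"
      by linarith
  next
    fix t assume "t \<in> T"
    then show "integrable unit_cell (\<lambda>x. u t x * torus_conv W (u t) x)"
      by (intro integrable_unit_cell_continuous continuous_intros cu cconv)
  next
    show "(\<lambda>x. v t0 x * torus_conv W (u t0) x + u t0 x * torus_conv W (v t0) x) \<in> borel_measurable unit_cell"
      by (intro borel_measurable_integrable integrable_unit_cell_continuous continuous_intros cv cu cconv T)
  qed

  have int: "integrable unit_cell (\<lambda>x. v t0 x * ln (u t0 x))"
      "integrable unit_cell (\<lambda>x. v t0 x * torus_conv W (u t0) x)"
      "integrable unit_cell (\<lambda>x. u t0 x * torus_conv W (v t0) x)"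
    by (intro integrable_unit_cell_continuous continuous_intros cv cu cln cconv T)+
  \<comment> \<open>The two terms of the product rule have the same integral.\<close>
  have sym: "(\<integral>x. u t0 x * torus_conv W (v t0) x \<partial>unit_cell) = (\<integral>x. v t0 x * torus_conv W (u t0) x \<partial>unit_cell)"
    using torus_conv_symmetric[OF W u(2) cu v(2) cv, OF T(3) T(3) T(3) T(3)] by (simp add: torus_integral_eq)
  have "(\<integral>x. v t0 x * ln (u t0 x) \<partial>unit_cell) -
      \<beta> * (\<integral>x. v t0 x * torus_conv W (u t0) x + u t0 x * torus_conv W (v t0) x \<partial>unit_cell) =
      (\<integral>x. v t0 x * ln (u t0 x) \<partial>unit_cell) - 2 * \<beta> * (\<integral>x. v t0 x * torus_conv W (u t0) x \<partial>unit_cell)"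
    unfolding Bochner_Integration.integral_add[OF int(2,3)] sym by simp
  also have "\<dots> = (\<integral>x. v t0 x * ln (u t0 x) - 2 * \<beta> * (v t0 x * torus_conv W (u t0) x) \<partial>unit_cell)"
    using int by simp
  also have "\<dots> = torus_integral (\<lambda>x. (ln (u t0 x) - 2 * \<beta> * torus_conv W (u t0) x) * v t0 x)"
    by (simp add: torus_integral_eq algebra_simps)
  finally show ?thesis
    using DERIV_diff[OF entropy DERIV_cmult[OF inter, of \<beta>]]
    by (simp only: free_energy_def torus_integral_eq)
qed

subsection \<open>The first variation and the dissipation of the free energy\<close>

definition potential :: "real \<Rightarrow> (real^'d \<Rightarrow> real) \<Rightarrow> (real^'d \<Rightarrow> real) \<Rightarrow> real^'d \<Rightarrow> real" where
  "potential \<beta> W \<rho> x = ln (\<rho> x) - 2 * \<beta> * torus_conv W \<rho> x"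

lemma torus_smooth_potential:
  assumes "interaction_kernel W" "torus_smooth \<rho>" "\<And>x. 0 < \<rho> x"
  shows "torus_smooth (potential \<beta> W \<rho>)"
proof -
  have "torus_smooth (\<lambda>x. ln (\<rho> x) + (- 2 * \<beta>) * torus_conv W \<rho> x)"
    by (intro torus_smooth_add torus_smooth_ln torus_smooth_mult torus_smooth_const
        torus_smooth_torus_conv assms)
  then show ?thesis by (simp add: potential_def[abs_def])
qed

lemma has_first_variation_potential:
  fixes W \<rho> :: "real^'d \<Rightarrow> real"
  assumes W: "interaction_kernel W" and \<rho>: "torus_smooth \<rho>" and pos: "\<And>x. 0 < \<rho> x"
  shows "has_first_variation (free_energy \<beta> W) \<rho> (potential \<beta> W \<rho>)"
  unfolding has_first_variation_def
proof (intro conjI allI impI)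
  note \<phi> = torus_smooth_potential[OF W \<rho> pos, of \<beta>]
  show "torus_fun (potential \<beta> W \<rho>)" by (rule torus_smooth_torus_fun[OF \<phi>])
  show "continuous_on UNIV (potential \<beta> W \<rho>)" by (rule torus_smooth_continuous[OF \<phi>])
  fix \<eta> :: "real^'d \<Rightarrow> real" assume \<eta>: "torus_smooth \<eta>"
  note per = torus_smooth_torus_fun[OF \<rho>] torus_smooth_torus_fun[OF \<eta>]
  note cont = torus_smooth_continuous[OF \<rho>] torus_smooth_continuous[OF \<eta>]
  have "continuous_on UNIV (\<lambda>x. \<eta> x / \<rho> x)"
    using pos by (intro continuous_intros cont) (metis less_irrefl)
  moreover have "torus_fun (\<lambda>x. \<eta> x / \<rho> x)" using per by (simp add: torus_fun_def)
  ultimately obtain N where N: "\<And>x. \<bar>\<eta> x / \<rho> x\<bar> \<le> N" using torus_fun_bounded by blast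
  \<comment> \<open>The factor \<open>1 + e * (\<eta> x / \<rho> x)\<close> of the perturbed density
    stays positive for \<open>\<bar>e\<bar> \<le> d\<close>, since
    \<open>d * \<bar>N\<bar> < 1\<close>.\<close>
  define d where "d = 1 / (\<bar>N\<bar> + 1)"
  have d: "0 < d" by (simp add: d_def)
  have pos': "0 < \<rho> x + e * \<eta> x" if "e \<in> {-d..d}" for e x
  proof -
    have "\<bar>e * (\<eta> x / \<rho> x)\<bar> \<le> d * \<bar>N\<bar>"
      using that N[of x] unfolding abs_mult by (intro mult_mono) auto
    also have "\<dots> < 1" by (simp add: d_def)
    finally have "0 < \<rho> x * (1 + e * (\<eta> x / \<rho> x))" by (intro mult_pos_pos pos) linarith
    then show ?thesis using pos[of x] by (simp add: distrib_left)
  qed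
  \<comment> \<open>The redexes exhibit the segment as a curve \<open>u\<close> and the constant
    \<eta> as its velocity \<open>v\<close>, in the shape of the chain rule.\<close>
  have "((\<lambda>e. free_energy \<beta> W ((\<lambda>e x. \<rho> x + e * \<eta> x) e)) has_real_derivative
      torus_integral (\<lambda>x. (ln ((\<lambda>e x. \<rho> x + e * \<eta> x) 0 x) -
        2 * \<beta> * torus_conv W ((\<lambda>e x. \<rho> x + e * \<eta> x) 0) x) * (\<lambda>e. \<eta>) 0 x)) (at 0 within {-d..d})"
  proof (rule free_energy_has_real_derivative[OF W])
    show "continuous_on ({-d..d} \<times> UNIV) (\<lambda>p. \<rho> (snd p) + fst p * \<eta> (snd p))"
      "continuous_on ({-d..d} \<times> UNIV) (\<lambda>p. \<eta> (snd p))"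
      by (intro continuous_intros continuous_on_compose2[OF cont(1)] continuous_on_compose2[OF cont(2)];
          simp)+
    show "torus_fun (\<lambda>x. \<rho> x + e * \<eta> x)" for e using per by (simp add: torus_fun_def)
    show "torus_fun \<eta>" by (rule per)
    show "((\<lambda>e. \<rho> x + e * \<eta> x) has_real_derivative \<eta> x) (at e within {-d..d})" for e x
      by (auto intro!: derivative_eq_intros)
  qed (use d pos' in auto)
  \<comment> \<open>As 0 is an interior point, the derivative is two-sided.\<close>
  moreover have "at 0 within {-d..d} = at (0::real)"
    using d by (intro at_within_interior) (simp add: interior_atLeastAtMost_real)
  ultimately show "((\<lambda>e. free_energy \<beta> W (\<lambda>x. \<rho> x + e * \<eta> x)) has_real_derivative
      torus_integral (\<lambda>x. potential \<beta> W \<rho> x * \<eta> x)) (at 0)"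
    by (simp add: potential_def)
qed

lemma first_variation_eq:
  assumes "has_first_variation F \<rho> \<phi>"
  shows "first_variation F \<rho> = \<phi>"
  unfolding first_variation_def using assms has_first_variation_unique by (intro the_equality) blast+

section \<open>Calculus of partial derivatives\<close>

lemma partial_derivI: "(f has_derivative f') (at x) \<Longrightarrow> partial_deriv i f x = f' (axis i 1)"
  by (simp add: partial_deriv_def frechet_derivative_at[symmetric])

lemma partial_deriv_mult:
  assumes "torus_smooth f" "torus_smooth g"
  shows "partial_deriv i (\<lambda>x. f x * g x) x = f x * partial_deriv i g x + partial_deriv i f x * g x"
  unfolding partial_deriv_def[of i f] partial_deriv_def[of i g]
  by (rule partial_derivI[OF has_derivative_mult[OF torus_smooth_has_derivative torus_smooth_has_derivative]])
    (rule assms)+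

lemma partial_deriv_exp:
  assumes "torus_smooth f"
  shows "partial_deriv i (\<lambda>x. exp (f x)) x = exp (f x) * partial_deriv i f x"
  using partial_derivI[OF has_derivative_exp[OF torus_smooth_has_derivative[OF assms]]]
  by (simp add: partial_deriv_def)

lemma partial_deriv_cmult:
  assumes "torus_smooth f"
  shows "partial_deriv i (\<lambda>x. c * f x) x = c * partial_deriv i f x"
  using partial_derivI[OF has_derivative_mult_right[OF torus_smooth_has_derivative[OF assms]]]
  by (simp add: partial_deriv_def)

text \<open>The integral of \<open>f (x + s *\<^sub>R axis i 1)\<close> does not depend on \<open>s\<close>; differentiate it at \<open>s = 0\<close>.\<close>

lemma torus_integral_partial_deriv:
  fixes f :: "real^'d \<Rightarrow> real"
  assumes f: "torus_smooth f"
  shows "torus_integral (partial_deriv i f) = 0"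
proof -
  note per = torus_smooth_torus_fun[OF f] torus_smooth_torus_fun[OF torus_smooth_partial_deriv[OF f]]
  note cont = torus_smooth_continuous[OF f] torus_smooth_continuous[OF torus_smooth_partial_deriv[OF f]]
  obtain C where C: "\<And>x. \<bar>f x\<bar> \<le> C" using torus_fun_bounded[OF per(1) cont(1)] by blast
  obtain D where D: "\<And>x. \<bar>partial_deriv i f x\<bar> \<le> D" using torus_fun_bounded[OF per(2) cont(2)] by blast
  have "((\<lambda>s. \<integral>x. f (x + s *\<^sub>R axis i 1) \<partial>unit_cell) has_real_derivative
      (\<integral>x. partial_deriv i f (x + 0 *\<^sub>R axis i 1) \<partial>unit_cell)) (at 0 within UNIV)"
  proof (rule integral_has_real_derivative[OF finite_measure_unit_cell])
    show "((\<lambda>s. f (x + s *\<^sub>R axis i 1)) has_real_derivative partial_deriv i f (x + s *\<^sub>R axis i 1)) (at s)" for s x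
    proof -
      have "((\<lambda>s. x + s *\<^sub>R axis i 1) has_derivative (\<lambda>h. h *\<^sub>R axis i 1)) (at s)"
        by (auto intro!: derivative_eq_intros)
      from has_derivative_compose[OF this torus_smooth_has_derivative[OF f]]
      have "((\<lambda>s. f (x + s *\<^sub>R axis i 1)) has_derivative
          (\<lambda>h. frechet_derivative f (at (x + s *\<^sub>R axis i 1)) (h *\<^sub>R axis i 1))) (at s)" .
      moreover have "frechet_derivative f (at (x + s *\<^sub>R axis i 1)) (h *\<^sub>R axis i 1) =
          partial_deriv i f (x + s *\<^sub>R axis i 1) * h" for h
        using linear_scale[OF has_derivative_linear[OF torus_smooth_has_derivative[OF f]]]
        by (simp add: partial_deriv_def mult.commute)
      ultimately show ?thesis by (simp add: has_field_derivative_def)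
    qed
    show "integrable unit_cell (\<lambda>x. f (x + s *\<^sub>R axis i 1))" for s
      by (intro integrable_unit_cell_continuous continuous_on_compose2[OF cont(1)] continuous_intros) auto
    show "(\<lambda>x. partial_deriv i f (x + 0 *\<^sub>R axis i 1)) \<in> borel_measurable unit_cell"
      using cont(2) by (intro measurable_unit_cell borel_measurable_continuous_onI) simp
  qed (use D in auto)
  moreover have "(\<integral>x. f (x + s *\<^sub>R axis i 1) \<partial>unit_cell) = torus_integral f" for s
    using torus_integral_translate[OF per(1) borel_measurable_continuous_onI[OF cont(1)] C, of "s *\<^sub>R axis i 1"]
    by (simp add: torus_integral_eq)
  ultimately have "((\<lambda>s. torus_integral f) has_real_derivative torus_integral (partial_deriv i f)) (at 0)"
    by (simp add: torus_integral_eq)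
  then show ?thesis using DERIV_unique[OF DERIV_const] by metis
qed

text \<open>Squaring the exponential doubles its exponent, and this 2 is exactly the one in front of
  \<beta> in the potential. Here the special form of \<open>G\<close> enters.\<close>

lemma exp_potential:
  "0 < \<rho> x \<Longrightarrow> (exp (- \<beta> * torus_conv W \<rho> x))\<^sup>2 * \<rho> x = exp (potential \<beta> W \<rho> x)"
  by (simp add: potential_def exp_diff exp_minus power2_eq_square field_simps flip: exp_add)

text \<open>The inner derivative of the Laplacian is carried out by the chain rule, the outer one is
  kept: the gradient flow identity and the integration by parts both start from this divergence
  form.\<close>

lemma fokker_planck_rhs_eq:
  fixes W \<rho> :: "real^'d \<Rightarrow> real"
  assumes W: "interaction_kernel W" and \<rho>: "torus_smooth \<rho>" and pos: "\<And>x. 0 < \<rho> x"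
  shows "fokker_planck_rhs (\<lambda>s. exp (- \<beta> * s)) W \<rho> x =
    (\<Sum>i\<in>UNIV. partial_deriv i (\<lambda>y. 1/2 * (exp (potential \<beta> W \<rho> y) * partial_deriv i (potential \<beta> W \<rho>) y)) x)"
proof -
  note \<phi> = torus_smooth_potential[OF W \<rho> pos, of \<beta>]
  have "partial_deriv i (\<lambda>y. exp (potential \<beta> W \<rho> y)) =
      (\<lambda>y. exp (potential \<beta> W \<rho> y) * partial_deriv i (potential \<beta> W \<rho>) y)" for i
    by (rule ext) (rule partial_deriv_exp[OF \<phi>])
  moreover have "(exp (- \<beta> * torus_conv W \<rho> y))\<^sup>2 * \<rho> y = exp (potential \<beta> W \<rho> y)" for y
    by (rule exp_potential) (rule pos)
  moreover have "partial_deriv i (\<lambda>y. 1/2 * (exp (potential \<beta> W \<rho> y) * partial_deriv i (potential \<beta> W \<rho>) y)) x =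
      1/2 * partial_deriv i (\<lambda>y. exp (potential \<beta> W \<rho> y) * partial_deriv i (potential \<beta> W \<rho>) y) x" for i
    by (intro partial_deriv_cmult torus_smooth_mult torus_smooth_exp torus_smooth_partial_deriv \<phi>)
  ultimately show ?thesis
    by (simp only: fokker_planck_rhs_def laplacian_def sum_distrib_left)
qed

text \<open>\<open>first_variation\<close> is a definite description, which uniqueness allows to
  replace by the potential. What remains is a regrouping of factors.\<close>

lemma gradient_flow_rhs_eq:
  fixes W \<rho> :: "real^'d \<Rightarrow> real"
  assumes W: "interaction_kernel W" and \<rho>: "torus_smooth \<rho>" and pos: "\<And>x. 0 < \<rho> x"
  shows "gradient_flow_rhs (\<lambda>s. exp (- \<beta> * s)) W (free_energy \<beta> W) \<rho> x =
    fokker_planck_rhs (\<lambda>s. exp (- \<beta> * s)) W \<rho> x"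
proof -
  have "1/2 * (exp (- \<beta> * torus_conv W \<rho> y))\<^sup>2 * \<rho> y * p = 1/2 * (exp (potential \<beta> W \<rho> y) * p)" for y p
    by (simp only: exp_potential[of \<rho> y, OF pos, symmetric] mult.assoc)
  then show ?thesis
    by (simp only: fokker_planck_rhs_eq[OF assms] gradient_flow_rhs_def divergence_def mobility_def
        first_variation_eq[OF has_first_variation_potential[OF assms]] gradient_def
        vector_scaleR_component real_scaleR_def vec_lambda_beta)
qed

lemma dissipation_nonpos:
  fixes W \<rho> :: "real^'d \<Rightarrow> real"
  assumes W: "interaction_kernel W" and \<rho>: "torus_smooth \<rho>" and pos: "\<And>x. 0 < \<rho> x"
  shows "torus_integral (\<lambda>x. potential \<beta> W \<rho> x * fokker_planck_rhs (\<lambda>s. exp (- \<beta> * s)) W \<rho> x) \<le> 0"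
proof -
  let ?\<phi> = "potential \<beta> W \<rho>"
  let ?V = "\<lambda>i y. 1/2 * (exp (?\<phi> y) * partial_deriv i ?\<phi> y)"
  note \<phi> = torus_smooth_potential[OF W \<rho> pos, of \<beta>]
  have V: "torus_smooth (?V i)" for i
    by (intro torus_smooth_mult torus_smooth_const torus_smooth_exp torus_smooth_partial_deriv \<phi>)
  have le: "(\<integral>x. ?\<phi> x * partial_deriv i (?V i) x \<partial>unit_cell) \<le> 0" for i
  proof -
    have int: "integrable unit_cell (\<lambda>x. ?\<phi> x * partial_deriv i (?V i) x)"
        "integrable unit_cell (\<lambda>x. partial_deriv i ?\<phi> x * ?V i x)"
      by (intro integrable_unit_cell_continuous torus_smooth_continuous torus_smooth_mult
          torus_smooth_partial_deriv V \<phi>)+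
    \<comment> \<open>The product is periodic, so its partial derivative integrates to 0 and
      integration by parts has no boundary term.\<close>
    have "0 = torus_integral (partial_deriv i (\<lambda>x. ?\<phi> x * ?V i x))"
      by (rule torus_integral_partial_deriv[OF torus_smooth_mult[OF \<phi> V], symmetric])
    also have "\<dots> = (\<integral>x. ?\<phi> x * partial_deriv i (?V i) x + partial_deriv i ?\<phi> x * ?V i x \<partial>unit_cell)"
      unfolding torus_integral_eq
      by (rule Bochner_Integration.integral_cong[OF refl]) (rule partial_deriv_mult[OF \<phi> V])
    also have "\<dots> = (\<integral>x. ?\<phi> x * partial_deriv i (?V i) x \<partial>unit_cell) +
        (\<integral>x. partial_deriv i ?\<phi> x * ?V i x \<partial>unit_cell)"
      by (rule Bochner_Integration.integral_add[OF int])
    \<comment> \<open>The integrand is half the exponential of the potential times the square of a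
      partial derivative.\<close>
    moreover have "0 \<le> (\<integral>x. partial_deriv i ?\<phi> x * ?V i x \<partial>unit_cell)"
      by (intro integral_nonneg_AE AE_I2) (simp add: mult.left_commute)
    ultimately show ?thesis by linarith
  qed
  have int: "integrable unit_cell (\<lambda>x. ?\<phi> x * partial_deriv i (?V i) x)" for i
    by (intro integrable_unit_cell_continuous torus_smooth_continuous torus_smooth_mult
        torus_smooth_partial_deriv V \<phi>)
  have "torus_integral (\<lambda>x. ?\<phi> x * fokker_planck_rhs (\<lambda>s. exp (- \<beta> * s)) W \<rho> x) =
      (\<integral>x. (\<Sum>i\<in>UNIV. ?\<phi> x * partial_deriv i (?V i) x) \<partial>unit_cell)"
    unfolding fokker_planck_rhs_eq[OF assms] torus_integral_eq sum_distrib_left ..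
  also have "\<dots> = (\<Sum>i\<in>UNIV. \<integral>x. ?\<phi> x * partial_deriv i (?V i) x \<partial>unit_cell)"
    by (rule Bochner_Integration.integral_sum) (rule int)
  also have "\<dots> \<le> 0" by (rule sum_nonpos) (rule le)
  finally show ?thesis .
qed

text \<open>The mean value theorem on \<open>{a..b}\<close>: at some time in between, the derivative
  is the dissipation term, which is nonpositive. Passing from \<open>I\<close> to this compact
  subinterval provides the uniform bounds.\<close>

lemma free_energy_antimono:
  fixes W :: "real^'d \<Rightarrow> real" and \<rho> :: "real \<Rightarrow> real^'d \<Rightarrow> real"
  assumes W: "interaction_kernel W" and I: "is_interval I"
    and sol: "smooth_positive_fp_solution (\<lambda>s. exp (- \<beta> * s)) W I \<rho>"
  shows "antimono_on I (\<lambda>t. free_energy \<beta> W (\<rho> t))"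
proof (rule monotone_onI)
  let ?G = "\<lambda>s. exp (- \<beta> * s)"
  fix a b assume a: "a \<in> I" and b: "b \<in> I" and "a \<le> b"
  show "free_energy \<beta> W (\<rho> b) \<le> free_energy \<beta> W (\<rho> a)"
  \<comment> \<open>For \<open>a < b\<close> derivatives within \<open>{a..b}\<close> are unique,
    which fails for a degenerate interval.\<close>
  proof (cases "a = b")
    case False
    then have ab: "a < b" using \<open>a \<le> b\<close> by simp
    let ?T = "{a..b}"
    have sub: "?T \<subseteq> I" using mem_is_interval_1_I[OF I a b] by auto
    have Ck: "Ck_on k (?T \<times> UNIV) (\<lambda>p. \<rho> (fst p) (snd p))" for k
      using sol sub by (auto simp: smooth_positive_fp_solution_def smooth_on_def intro: Ck_on_subset)
    have per: "torus_fun (\<rho> t)" and pos: "0 < \<rho> t x" if "t \<in> ?T" for t x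
      using sol sub that by (auto simp: smooth_positive_fp_solution_def)
    have fp: "((\<lambda>s. \<rho> s x) has_real_derivative fokker_planck_rhs ?G W (\<rho> t) x) (at t within ?T)"
      if "t \<in> ?T" for t x
    proof -
      have "((\<lambda>s. \<rho> s x) has_real_derivative fokker_planck_rhs ?G W (\<rho> t) x) (at t within I)"
        using sol sub that by (auto simp only: smooth_positive_fp_solution_def)
      then show ?thesis using sub by (rule has_field_derivative_subset)
    qed
    have smooth: "torus_smooth (\<rho> t)" if "t \<in> ?T" for t
      using per[OF that] Ck_on_slice[OF Ck that] by (auto intro: torus_smoothI)
    obtain \<rho>' where \<rho>': "\<And>p. p \<in> ?T \<times> UNIV \<Longrightarrow>
        ((\<lambda>p. \<rho> (fst p) (snd p)) has_derivative \<rho>' p) (at p within ?T \<times> UNIV)"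
      "\<And>h. Ck_on 0 (?T \<times> UNIV) (\<lambda>p. \<rho>' p h)"
      using Ck[of "Suc 0"] by (elim Ck_on_SucE) blast
    \<comment> \<open>The equation is only given pointwise, whereas the chain rule for the energy
      needs a jointly continuous velocity. Identifying the right-hand side with the time component
      of the joint derivative of \<rho> supplies this.\<close>
    have dt: "\<rho>' (t, x) (1, 0) = fokker_planck_rhs ?G W (\<rho> t) x" if t: "t \<in> ?T" for t x
    proof -
      have "((\<lambda>s. (s, x)) has_derivative (\<lambda>h. (h, 0))) (at t within ?T)"
        by (auto intro!: derivative_eq_intros)
      from has_derivative_in_compose2[OF \<rho>'(1) _ t this]
      have d: "((\<lambda>s. \<rho> s x) has_derivative (\<lambda>h. \<rho>' (t, x) (h, 0))) (at t within ?T)"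
        by auto
      moreover have "\<rho>' (t, x) (h, 0) = \<rho>' (t, x) (1, 0) * h" for h
        using linear_scale[OF has_derivative_linear[OF \<rho>'(1)], of "(t, x)" h "(1, 0)"] t
        by (simp add: mult.commute)
      then have "(\<lambda>h. \<rho>' (t, x) (h, 0)) = (*) (\<rho>' (t, x) (1, 0))" by (rule ext)
      ultimately have "((\<lambda>s. \<rho> s x) has_real_derivative \<rho>' (t, x) (1, 0)) (at t within ?T)"
        unfolding has_field_derivative_def by (simp only:)
      then show ?thesis
        using vector_derivative_unique_within_closed_interval[of a b t "\<lambda>s. \<rho> s x"] ab t fp[OF t]
        by (auto simp: has_real_derivative_iff_has_vector_derivative)
    qed
    have energy': "((\<lambda>t. free_energy \<beta> W (\<rho> t)) has_real_derivative
        torus_integral (\<lambda>x. potential \<beta> W (\<rho> t) x * fokker_planck_rhs ?G W (\<rho> t) x)) (at t within ?T)"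
      if t: "t \<in> ?T" for t
      unfolding potential_def
    proof (rule free_energy_has_real_derivative[OF W _ _ t])
      show "continuous_on (?T \<times> UNIV) (\<lambda>p. \<rho> (fst p) (snd p))"
        by (rule Ck_on_continuous[OF Ck])
      have "continuous_on (?T \<times> UNIV) (\<lambda>p. \<rho>' p (1, 0))"
        using \<rho>'(2) by simp
      then show "continuous_on (?T \<times> UNIV) (\<lambda>p. fokker_planck_rhs ?G W (\<rho> (fst p)) (snd p))"
        by (rule continuous_on_eq) (auto simp: dt)
      fix s assume s: "s \<in> ?T"
      have "torus_smooth (fokker_planck_rhs ?G W (\<rho> s))"
        unfolding fokker_planck_rhs_eq[OF W smooth[OF s] pos[OF s], abs_def]
        by (intro torus_smooth_sum torus_smooth_partial_deriv torus_smooth_mult torus_smooth_const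
            torus_smooth_exp torus_smooth_potential W smooth s pos)
      then show "torus_fun (fokker_planck_rhs ?G W (\<rho> s))" by (rule torus_smooth_torus_fun)
    qed (use per pos fp in auto)
    have "\<exists>t\<in>?T. free_energy \<beta> W (\<rho> b) - free_energy \<beta> W (\<rho> a) =
        torus_integral (\<lambda>x. potential \<beta> W (\<rho> t) x * fokker_planck_rhs ?G W (\<rho> t) x) * (b - a)"
      by (rule mvt_very_simple[OF \<open>a \<le> b\<close> energy'[unfolded has_field_derivative_def]]) simp
    then obtain t where t: "t \<in> ?T" "free_energy \<beta> W (\<rho> b) - free_energy \<beta> W (\<rho> a) =
        torus_integral (\<lambda>x. potential \<beta> W (\<rho> t) x * fokker_planck_rhs ?G W (\<rho> t) x) * (b - a)"
      by blast
    have "\<dots> \<le> 0"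
      using dissipation_nonpos[OF W smooth[OF t(1)] pos[OF t(1)], of \<beta>] ab
      by (intro mult_nonpos_nonneg) auto
    then show ?thesis using t(2) by linarith
  qed simp
qed

text \<open>Unique existence and smoothness give the identity its meaning: \<open>THE\<close> and
  \<open>frechet_derivative\<close> return unspecified values when there is no unique first
  variation or no derivative.\<close>

theorem proposition1:
  fixes \<beta> :: real and G :: "real \<Rightarrow> real" and W :: "real^'d \<Rightarrow> real"
  assumes "\<beta> > 0"
    and "G = (\<lambda>s. exp (- \<beta> * s))"
    and "interaction_kernel W"
  shows "(\<forall>\<rho>. torus_smooth \<rho> \<and> (\<forall>x. 0 < \<rho> x) \<longrightarrow>
            (\<exists>!\<phi>. has_first_variation (free_energy \<beta> W) \<rho> \<phi>) \<and>
            torus_smooth (first_variation (free_energy \<beta> W) \<rho>) \<and>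
            torus_smooth (\<lambda>x. (G (torus_conv W \<rho> x))\<^sup>2 * \<rho> x) \<and>
            (\<forall>x. fokker_planck_rhs G W \<rho> x = gradient_flow_rhs G W (free_energy \<beta> W) \<rho> x)) \<and>
         (\<forall>I \<rho>. is_interval I \<and> smooth_positive_fp_solution G W I \<rho> \<longrightarrow>
            antimono_on I (\<lambda>t. free_energy \<beta> W (\<rho> t)))"
proof (intro conjI allI impI)
  note W = assms(3)
  fix \<rho> :: "real^'d \<Rightarrow> real" assume "torus_smooth \<rho> \<and> (\<forall>x. 0 < \<rho> x)"
  then have \<rho>: "torus_smooth \<rho>" and pos: "\<And>x. 0 < \<rho> x" by auto
  note fv = has_first_variation_potential[OF W \<rho> pos, of \<beta>]
  note \<phi> = torus_smooth_potential[OF W \<rho> pos, of \<beta>]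
  show "\<exists>!\<phi>. has_first_variation (free_energy \<beta> W) \<rho> \<phi>"
    using fv has_first_variation_unique by blast
  show "torus_smooth (first_variation (free_energy \<beta> W) \<rho>)"
    using \<phi> first_variation_eq[OF fv] by simp
  have "(G (torus_conv W \<rho> x))\<^sup>2 * \<rho> x = exp (potential \<beta> W \<rho> x)" for x
    unfolding assms(2) by (rule exp_potential) (rule pos)
  then show "torus_smooth (\<lambda>x. (G (torus_conv W \<rho> x))\<^sup>2 * \<rho> x)"
    by (simp only: torus_smooth_exp[OF \<phi>])
  show "fokker_planck_rhs G W \<rho> x = gradient_flow_rhs G W (free_energy \<beta> W) \<rho> x" for x
    unfolding assms(2) by (rule gradient_flow_rhs_eq[OF W \<rho> pos, symmetric])
next
  fix I \<rho> assume "is_interval I \<and> smooth_positive_fp_solution G W I \<rho>"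
  then show "antimono_on I (\<lambda>t. free_energy \<beta> W (\<rho> t))"
    using free_energy_antimono[OF assms(3)] assms(2) by blast
qed

end
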